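(* Let $p$ satisfy $\frac{1}{2} \le p < 1$. Suppose you have $n \ge 3$ remaining coins, you toss them all, and $j$ of them land heads. Then it is always optimal (for maximizing the expected total number of heads) to follow one of the following two strategies: (A) set aside exactly one coin, unless $j = n$, in which case you set aside all of them; (B) set aside exactly one coin, unless $j = n$ or $j = n-1$, in which cases you set aside all the heads. Moreover, with $\phi = \frac{\sqrt{5}-1}{2} \approx 0.618$ there is a constant $p_0 \approx 0.5495021777642$ such that exactly one of the following holds for a given $p \in [\frac12, 1)$: (1) if $\phi \le p < 1$, it is optimal to follow strategy A for all $n \ge 3$; (2) if $p_0 < p < \phi$, there is an absolute constant $s'(p_0) > 0$ and a positive integer $n(p) = \left\lfloor \frac{\log(p-p_0) + \log(s'(p_0))}{\log(p_0)} + o(1) \right\rfloor$ (where $o(1)$ denotes a quantity tending to $0$ as $p \to p_0^{+}$, i.e. as $n(p) \to \infty$) such that it is optimal to follow strategy A when the number $n$ of remaining coins satisfies $n > n(p)$, and to follow strategy B once the number of remaining coins is at most $n(p)$; (3) if $\frac{1}{2} \le p \le p_0$, it is optimal to follow strategy B for all $n \ge 3$.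
   Context: Game: start with $n$ coins, each independently landing heads with probability $p$. In each round all remaining coins are tossed, and then at least one of the tossed coins must be set aside (never tossed again, its face counting toward the final total); the remaining coins are tossed in the next round, until all coins are set aside. The goal is to maximize the expected total number of heads among the set-aside coins. Let $v_{n,p}$ be this maximal expected value; equivalently $v_{0,p}=0$ and for $n \ge 1$, $v_{n,p} = np^n + v_{n-1,p}(1-p)^n + \sum_{j=1}^{n-1}\binom{n}{j}p^j(1-p)^{n-j}\max_{1\le i\le j}(v_{n-i,p}+i)$. Set $s_n(p) = v_{n,p} - n + 1 - p$ and $s(p) = \lim_{n\to\infty} s_n(p)$; the constant $p_0$ is the unique zero of $s$ in $[\frac12,1)$ and $s'(p_0)$ is the derivative of $s$ at $p_0$. *)

theory Defs
  imports "HOL-Probability.Probability"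
begin

(* Coins are exchangeable, so a position is the number of coins in play. A round is recorded as
   (number of coins tossed, number of heads among them). A strategy sees all rounds so far, the
   current one first, and returns (a, b): set aside a heads and b tails. Its own past choices are
   determined by the recorded rounds. *)

type_synonym strategy = "(nat \<times> nat) list \<Rightarrow> nat \<times> nat"

definition moves :: "nat \<Rightarrow> nat \<Rightarrow> (nat \<times> nat) set" where
  "moves n j = {(a, b). a \<le> j \<and> b \<le> n - j \<and> 1 \<le> a + b}"

definition legal :: "strategy \<Rightarrow> bool" where
  "legal \<sigma> \<longleftrightarrow> (\<forall>h n j. 1 \<le> n \<longrightarrow> j \<le> n \<longrightarrow> \<sigma> ((n, j) # h) \<in> moves n j)"

(* Distribution of the total number of heads set aside from now on, with n coins in play after
   the rounds h. For legal strategies max 1 (a + b) = a + b; the max only makes the recursion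
   terminate for illegal ones. *)

function total_heads :: "strategy \<Rightarrow> real \<Rightarrow> (nat \<times> nat) list \<Rightarrow> nat \<Rightarrow> nat pmf" where
  "total_heads \<sigma> p h n =
     (if n = 0 then return_pmf 0
      else bind_pmf (binomial_pmf n p) (\<lambda>j.
        let (a, b) = \<sigma> ((n, j) # h)
        in map_pmf (\<lambda>t. a + t) (total_heads \<sigma> p ((n, j) # h) (n - max 1 (a + b)))))"
  by auto
termination
  by (relation "Wellfounded.measure (\<lambda>(\<sigma>, p, h, n). n)") auto

declare total_heads.simps [simp del]

definition v :: "nat \<Rightarrow> real \<Rightarrow> real" where
  "v n p = (SUP \<sigma>\<in>{\<sigma>. legal \<sigma>}. measure_pmf.expectation (total_heads \<sigma> p [] n) real)"

(* With n coins tossed and j of them heads, setting aside a heads and b tails and continuing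
   optimally is worth a + v (n - a - b) p. *)

definition optimal_move :: "real \<Rightarrow> nat \<Rightarrow> nat \<Rightarrow> nat \<times> nat \<Rightarrow> bool" where
  "optimal_move p n j m \<longleftrightarrow> m \<in> moves n j \<and>
     (\<forall>(a', b')\<in>moves n j.
        real a' + v (n - a' - b') p \<le> real (fst m) + v (n - fst m - snd m) p)"

(* A single coin that is set aside is a head whenever some coin landed heads. *)

definition strategy_A :: "nat \<Rightarrow> nat \<Rightarrow> nat \<times> nat" where
  "strategy_A n j = (if j = n then (n, 0) else if j = 0 then (0, 1) else (1, 0))"

definition strategy_B :: "nat \<Rightarrow> nat \<Rightarrow> nat \<times> nat" where
  "strategy_B n j = (if j = n \<or> j = n - 1 then (j, 0) else if j = 0 then (0, 1) else (1, 0))"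

definition optimal_at :: "real \<Rightarrow> nat \<Rightarrow> (nat \<Rightarrow> nat \<Rightarrow> nat \<times> nat) \<Rightarrow> bool" where
  "optimal_at p n S \<longleftrightarrow> (\<forall>j\<le>n. optimal_move p n j (S n j))"

definition s_seq :: "nat \<Rightarrow> real \<Rightarrow> real" where
  "s_seq n p = v n p - real n + 1 - p"

definition s :: "real \<Rightarrow> real" where
  "s p = lim (\<lambda>n. s_seq n p)"

definition \<phi> :: real where
  "\<phi> = (sqrt 5 - 1) / 2"

(* What follows shows that v obeys the recurrence in which only heads are set aside, except that a
   single tail is set aside when there is no head (v_recurrence). *)

lemma finite_moves [simp]: "finite (moves n j)"
  by (rule finite_subset[of _ "{..j} \<times> {..n - j}"]) (auto simp: moves_def)

lemma moves_nonempty: "1 \<le> n \<Longrightarrow> j \<le> n \<Longrightarrow> moves n j \<noteq> {}"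
proof -
  assume "1 \<le> n" "j \<le> n"
  then have "(if j = 0 then (0, 1) else (1, 0)) \<in> moves n j"
    by (auto simp: moves_def)
  then show ?thesis by blast
qed

definition expected_heads :: "strategy \<Rightarrow> real \<Rightarrow> (nat \<times> nat) list \<Rightarrow> nat \<Rightarrow> real" where
  "expected_heads \<sigma> p h n = measure_pmf.expectation (total_heads \<sigma> p h n) real"

lemma finite_set_total_heads:
  assumes "p \<in> {0..1}"
  shows "finite (set_pmf (total_heads \<sigma> p h n))"
proof (induction n arbitrary: h rule: less_induct)
  case (less n)
  show ?case
    by (subst total_heads.simps)
       (auto simp: Let_def split_def assms intro!: finite_UN_I finite_imageI less.IH
           finite_set_pmf_binomial_pmf[OF assms])
qed

lemma expected_heads_0 [simp]: "expected_heads \<sigma> p h 0 = 0"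
  by (simp add: expected_heads_def total_heads.simps[of _ _ _ 0])

lemma expected_heads_step:
  assumes p: "p \<in> {0..1}" and n: "1 \<le> n"
  shows "expected_heads \<sigma> p h n =
    (\<Sum>j\<le>n. real (n choose j) * p ^ j * (1 - p) ^ (n - j) *
       (real (fst (\<sigma> ((n, j) # h))) + expected_heads \<sigma> p ((n, j) # h)
          (n - max 1 (fst (\<sigma> ((n, j) # h)) + snd (\<sigma> ((n, j) # h))))))"
proof -
  let ?m = "\<lambda>j. n - max 1 (fst (\<sigma> ((n, j) # h)) + snd (\<sigma> ((n, j) # h)))"
  let ?T = "\<lambda>j. total_heads \<sigma> p ((n, j) # h) (?m j)"
  let ?Q = "\<lambda>j. map_pmf (\<lambda>t. fst (\<sigma> ((n, j) # h)) + t) (?T j)"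
  have E: "measure_pmf.expectation (?Q j) real =
      real (fst (\<sigma> ((n, j) # h))) + expected_heads \<sigma> p ((n, j) # h) (?m j)" for j
  proof -
    have "integrable (measure_pmf (?T j)) real"
      by (rule integrable_measure_pmf_finite) (rule finite_set_total_heads[OF p])
    then show ?thesis
      by (simp add: expected_heads_def)
  qed
  have "expected_heads \<sigma> p h n =
      measure_pmf.expectation (bind_pmf (binomial_pmf n p) ?Q) real"
    unfolding expected_heads_def
    by (subst total_heads.simps) (use n in \<open>simp add: Let_def split_def\<close>)
  also have "\<dots> = (\<Sum>j\<le>n. pmf (binomial_pmf n p) j * measure_pmf.expectation (?Q j) real)"
    by (subst pmf_expectation_bind[where A = "{..n}"])
       (use p in \<open>auto simp: set_pmf_binomial_eq finite_set_total_heads split: if_splits\<close>)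
  finally show ?thesis
    using p by (simp only: E pmf_binomial atLeastAtMost_iff)
qed

fun bellman :: "nat \<Rightarrow> real \<Rightarrow> real" where
  "bellman n p = (if n = 0 then 0 else
     (\<Sum>j\<le>n. real (n choose j) * p ^ j * (1 - p) ^ (n - j) *
        Max ((\<lambda>(a, b). real a + bellman (n - max 1 (a + b)) p) ` moves n j)))"

declare bellman.simps [simp del]

lemma bellman_0 [simp]: "bellman 0 p = 0"
  by (simp add: bellman.simps)

lemma bellman_step:
  "1 \<le> n \<Longrightarrow> bellman n p = (\<Sum>j\<le>n. real (n choose j) * p ^ j * (1 - p) ^ (n - j) *
        Max ((\<lambda>(a, b). real a + bellman (n - max 1 (a + b)) p) ` moves n j))"
  by (subst bellman.simps) simp

lemma expected_heads_le_bellman: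
  assumes p: "p \<in> {0..1}" and "legal \<sigma>"
  shows "expected_heads \<sigma> p h n \<le> bellman n p"
proof (induction n arbitrary: h rule: less_induct)
  case (less n)
  show ?case
  proof (cases "n = 0")
    case False
    then have n: "1 \<le> n" by simp
    show ?thesis
      unfolding expected_heads_step[OF p n] bellman_step[OF n]
    proof (intro sum_mono mult_left_mono)
      fix j assume "j \<in> {..n}"
      then have "\<sigma> ((n, j) # h) \<in> moves n j"
        using \<open>legal \<sigma>\<close> n by (simp add: legal_def)
      then have "real (fst (\<sigma> ((n, j) # h))) +
          bellman (n - max 1 (fst (\<sigma> ((n, j) # h)) + snd (\<sigma> ((n, j) # h)))) p
        \<le> Max ((\<lambda>(a, b). real a + bellman (n - max 1 (a + b)) p) ` moves n j)"
        by (intro Max_ge) (auto simp: split_def)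
      moreover have "expected_heads \<sigma> p ((n, j) # h)
          (n - max 1 (fst (\<sigma> ((n, j) # h)) + snd (\<sigma> ((n, j) # h)))) \<le>
        bellman (n - max 1 (fst (\<sigma> ((n, j) # h)) + snd (\<sigma> ((n, j) # h)))) p"
        by (rule less.IH) (use n in auto)
      ultimately show "real (fst (\<sigma> ((n, j) # h))) + expected_heads \<sigma> p ((n, j) # h)
          (n - max 1 (fst (\<sigma> ((n, j) # h)) + snd (\<sigma> ((n, j) # h)))) \<le>
        Max ((\<lambda>(a, b). real a + bellman (n - max 1 (a + b)) p) ` moves n j)"
        by linarith
    qed (use p in auto)
  qed auto
qed

lemma bellman_attained:
  assumes p: "p \<in> {0..1}"
  obtains \<sigma> where "legal \<sigma>" and "\<And>h n. expected_heads \<sigma> p h n = bellman n p"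
proof -
  let ?f = "\<lambda>n (a, b). real a + bellman (n - max 1 (a + b)) p"
  let ?best = "\<lambda>n j m. m \<in> moves n j \<and> ?f n m = Max (?f n ` moves n j)"
  define g where "g n j = (SOME m. ?best n j m)" for n j
  have g: "?best n j (g n j)" if "1 \<le> n" "j \<le> n" for n j
  proof -
    have "Max (?f n ` moves n j) \<in> ?f n ` moves n j"
      using that by (intro Max_in) (auto simp: moves_nonempty)
    then have "\<exists>m. ?best n j m" by fastforce
    then show ?thesis unfolding g_def by (rule someI_ex)
  qed
  define \<sigma> :: strategy where "\<sigma> h = (case h of [] \<Rightarrow> (0, 0) | (n, j) # _ \<Rightarrow> g n j)" for h
  have "legal \<sigma>"
    using g by (simp add: legal_def \<sigma>_def)
  moreover have "expected_heads \<sigma> p h n = bellman n p" for h n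
  proof (induction n arbitrary: h rule: less_induct)
    case (less n)
    show ?case
    proof (cases "n = 0")
      case False
      then have n: "1 \<le> n" by simp
      show ?thesis
        unfolding expected_heads_step[OF p n] bellman_step[OF n]
      proof (rule sum.cong[OF refl], rule arg_cong[where f = "(*) x" for x])
        fix j assume "j \<in> {..n}"
        with g[OF n, of j] have "?f n (g n j) = Max (?f n ` moves n j)" by simp
        moreover have "expected_heads \<sigma> p ((n, j) # h) (n - max 1 (fst (g n j) + snd (g n j))) =
            bellman (n - max 1 (fst (g n j) + snd (g n j))) p"
          by (rule less.IH) (use n in auto)
        ultimately show "real (fst (\<sigma> ((n, j) # h))) + expected_heads \<sigma> p ((n, j) # h)
            (n - max 1 (fst (\<sigma> ((n, j) # h)) + snd (\<sigma> ((n, j) # h)))) =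
          Max (?f n ` moves n j)"
          by (simp add: \<sigma>_def split_def)
      qed
    qed auto
  qed
  ultimately show ?thesis by (rule that)
qed

lemma v_eq_bellman:
  assumes p: "p \<in> {0..1}"
  shows "v n p = bellman n p"
proof -
  obtain \<sigma> where \<sigma>: "legal \<sigma>" "\<And>h n. expected_heads \<sigma> p h n = bellman n p"
    using bellman_attained[OF p] by metis
  have "(SUP \<sigma>\<in>{\<sigma>. legal \<sigma>}. expected_heads \<sigma> p [] n) = bellman n p"
  proof (rule cSup_eq_maximum)
    show "bellman n p \<in> (\<lambda>\<sigma>. expected_heads \<sigma> p [] n) ` {\<sigma>. legal \<sigma>}"
      using \<sigma> by (intro image_eqI[where x = \<sigma>]) auto
  qed (use expected_heads_le_bellman[OF p] in auto)
  then show ?thesis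
    by (simp add: v_def expected_heads_def)
qed

lemma v_0 [simp]: "v 0 p = 0"
proof -
  have "legal (\<lambda>h. case h of [] \<Rightarrow> (0, 0) | (n, j) # _ \<Rightarrow> (j, n - j))"
    by (auto simp: legal_def moves_def)
  then have "{\<sigma>. legal \<sigma>} \<noteq> {}" by blast
  then show ?thesis
    by (simp add: v_def total_heads.simps[of _ _ _ 0])
qed

lemma v_optimality_equation:
  assumes p: "p \<in> {0..1}" and n: "1 \<le> n"
  shows "v n p = (\<Sum>j\<le>n. real (n choose j) * p ^ j * (1 - p) ^ (n - j) *
           Max ((\<lambda>(a, b). real a + v (n - a - b) p) ` moves n j))"
proof -
  have "(\<lambda>(a, b). real a + bellman (n - max 1 (a + b)) p) ` moves n j =
      (\<lambda>(a, b). real a + v (n - a - b) p) ` moves n j" for j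
    by (rule image_cong)
       (auto simp: moves_def max_def v_eq_bellman[OF p] intro!: arg_cong2[where f = bellman])
  then show ?thesis
    by (simp add: v_eq_bellman[OF p, of n] bellman_step[OF n])
qed

lemma sum_binomial_weights:
  "(\<Sum>j\<le>n. real (n choose j) * p ^ j * (1 - p) ^ (n - j)) = 1"
  using binomial_ring[of p "1 - p" n] by simp

lemma v_mono_Suc:
  assumes p: "p \<in> {0..1}"
  shows "v n p \<le> v (Suc n) p"
proof -
  have "v n p = (\<Sum>j\<le>Suc n. real (Suc n choose j) * p ^ j * (1 - p) ^ (Suc n - j) * v n p)"
    by (subst sum_distrib_right[symmetric], subst sum_binomial_weights) simp
  also have "\<dots> \<le> v (Suc n) p"
    unfolding v_optimality_equation[OF p, of "Suc n", OF Suc_le_mono[THEN iffD2, OF le0, of n, folded One_nat_def]]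
  proof (intro sum_mono mult_left_mono)
    fix j assume j: "j \<in> {..Suc n}"
    let ?F = "(\<lambda>(a, b). real a + v (Suc n - a - b) p) ` moves (Suc n) j"
    show "v n p \<le> Max ?F"
    proof (cases "j = 0")
      case True
      then have "(0, 1) \<in> moves (Suc n) j" by (simp add: moves_def)
      then have "real 0 + v (Suc n - 0 - 1) p \<le> Max ?F"
        by (intro Max_ge image_eqI[where x = "(0, 1)"]) auto
      then show ?thesis by simp
    next
      case False
      then have "(1, 0) \<in> moves (Suc n) j" by (simp add: moves_def)
      then have "real 1 + v (Suc n - 1 - 0) p \<le> Max ?F"
        by (intro Max_ge image_eqI[where x = "(1, 0)"]) auto
      then show ?thesis by simp
    qed
  qed (use p in auto)
  finally show ?thesis .
qed

lemma v_mono: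
  assumes "p \<in> {0..1}" and "m \<le> n"
  shows "v m p \<le> v n p"
  using lift_Suc_mono_le[of "\<lambda>n. v n p"] v_mono_Suc[OF assms(1)] assms(2) by blast

lemma v_le:
  assumes p: "p \<in> {0..1}"
  shows "v n p \<le> real n"
proof (induction n rule: less_induct)
  case (less n)
  show ?case
  proof (cases "n = 0")
    case False
    then have n: "1 \<le> n" by simp
    have "v n p \<le> (\<Sum>j\<le>n. real (n choose j) * p ^ j * (1 - p) ^ (n - j) * real n)"
      unfolding v_optimality_equation[OF p n]
    proof (intro sum_mono mult_left_mono)
      fix j assume "j \<in> {..n}"
      then have j: "j \<le> n" by simp
      have "real a + v (n - a - b) p \<le> real n" if "(a, b) \<in> moves n j" for a b
      proof -
        have "v (n - a - b) p \<le> real (n - a - b)"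
          by (rule less.IH) (use that n in \<open>auto simp: moves_def\<close>)
        moreover have "a + (n - a - b) \<le> n"
          using that j by (auto simp: moves_def)
        ultimately show ?thesis by linarith
      qed
      then show "Max ((\<lambda>(a, b). real a + v (n - a - b) p) ` moves n j) \<le> real n"
        using moves_nonempty[OF n j] by (subst Max_le_iff) auto
    qed (use p in auto)
    also have "\<dots> = real n"
      by (subst sum_distrib_right[symmetric], subst sum_binomial_weights) simp
    finally show ?thesis .
  qed auto
qed

theorem v_recurrence:
  assumes p: "p \<in> {0..1}" and n: "1 \<le> n"
  shows "v n p = real n * p ^ n + v (n - 1) p * (1 - p) ^ n +
    (\<Sum>j = 1..n - 1. real (n choose j) * p ^ j * (1 - p) ^ (n - j) *
       Max ((\<lambda>i. v (n - i) p + real i) ` {1..j}))"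
proof -
  let ?M = "\<lambda>j. Max ((\<lambda>(a, b). real a + v (n - a - b) p) ` moves n j)"
  let ?w = "\<lambda>j. real (n choose j) * p ^ j * (1 - p) ^ (n - j)"
  have M0: "?M 0 = v (n - 1) p"
  proof (rule Max_eqI)
    show "v (n - 1) p \<in> (\<lambda>(a, b). real a + v (n - a - b) p) ` moves n 0"
      by (rule image_eqI[where x = "(0, 1)"]) (use n in \<open>auto simp: moves_def\<close>)
  next
    fix y assume "y \<in> (\<lambda>(a, b). real a + v (n - a - b) p) ` moves n 0"
    then show "y \<le> v (n - 1) p"
      by (auto simp: moves_def intro!: v_mono[OF p])
  qed auto
  have Mj: "?M j = Max ((\<lambda>i. v (n - i) p + real i) ` {1..j})" if j: "1 \<le> j" "j \<le> n" for j
  proof (rule antisym)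
    let ?R = "Max ((\<lambda>i. v (n - i) p + real i) ` {1..j})"
    have R: "v (n - i) p + real i \<le> ?R" if "i \<in> {1..j}" for i
      by (rule Max_ge) (use that in auto)
    have "real a + v (n - a - b) p \<le> ?R" if ab: "(a, b) \<in> moves n j" for a b
    proof (cases "a = 0")
      case True
      then have "v (n - a - b) p \<le> v (n - 1) p"
        using ab by (intro v_mono[OF p]) (auto simp: moves_def)
      with True R[of 1] j show ?thesis by simp
    next
      case False
      have "v (n - a - b) p \<le> v (n - a) p"
        by (intro v_mono[OF p]) auto
      moreover have "v (n - a) p + real a \<le> ?R"
        by (rule R) (use False ab in \<open>auto simp: moves_def\<close>)
      ultimately show ?thesis by linarith
    qed
    then show "?M j \<le> ?R"
      using moves_nonempty[OF n j(2)] by (subst Max_le_iff) auto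
    have "v (n - i) p + real i \<in> (\<lambda>(a, b). real a + v (n - a - b) p) ` moves n j"
      if "i \<in> {1..j}" for i
      by (rule image_eqI[where x = "(i, 0)"]) (use that in \<open>auto simp: moves_def\<close>)
    then show "?R \<le> ?M j"
      using j by (intro Max_mono) auto
  qed
  have Mn: "?M n = real n"
  proof (rule Max_eqI)
    show "real n \<in> (\<lambda>(a, b). real a + v (n - a - b) p) ` moves n n"
      by (rule image_eqI[where x = "(n, 0)"]) (use n in \<open>auto simp: moves_def\<close>)
  next
    fix y assume "y \<in> (\<lambda>(a, b). real a + v (n - a - b) p) ` moves n n"
    then obtain a where "a \<le> n" "y = real a + v (n - a) p"
      by (auto simp: moves_def)
    with v_le[OF p, of "n - a"] show "y \<le> real n" by simp
  qed auto
  have split: "{..n} = insert 0 (insert n {1..n - 1})"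
    using n by auto
  have "v n p = (\<Sum>j\<le>n. ?w j * ?M j)"
    by (rule v_optimality_equation[OF p n])
  also have "\<dots> = ?w 0 * ?M 0 + (?w n * ?M n + (\<Sum>j = 1..n - 1. ?w j * ?M j))"
    unfolding split using n by (subst sum.insert; (subst sum.insert)?) simp_all
  also have "(\<Sum>j = 1..n - 1. ?w j * ?M j) =
      (\<Sum>j = 1..n - 1. ?w j * Max ((\<lambda>i. v (n - i) p + real i) ` {1..j}))"
    using Mj by (intro sum.cong) auto
  finally show ?thesis
    unfolding M0 Mn by (simp add: algebra_simps)
qed

end

theory Submission
  imports Defs "HOL-Real_Asymp.Real_Asymp"
begin

text \<open>
  Write \<open>s\<^sub>n\<close> for \<open>s_seq n p\<close>. Setting aside \<open>i\<close> heads out of \<open>n\<close> coins is worth \<open>s\<^sub>n\<^sub>-\<^sub>i\<close> up to a constant, and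
  \<open>s\<^sub>1 = 0\<close>, so B is optimal while the increasing sequence \<open>s\<^sub>2, s\<^sub>3, \<dots>\<close> is nonpositive, and A is optimal once
  it is nonnegative. Under B the sequence obeys
  \<open>s\<^sub>n = s\<^sub>n\<^sub>-\<^sub>1 (1 - p\<^sup>n - n p\<^sup>n\<^sup>-\<^sup>1 (1 - p)) + p\<^sup>n (1 - p) - (1 - p)\<^sup>n\<close>, whose limit is
  differentiable in \<open>p\<close> and strictly increasing as long as the sequence stays nonpositive, which allows
  only a single zero \<open>p\<^sub>0\<close>. For \<open>p > p\<^sub>0\<close>, let \<open>N\<close> be the first index with \<open>s\<^sub>N > 0\<close>.
  The part of the B-limit accumulated after \<open>N\<close> is \<open>p\<^sup>N\<^sup>+\<^sup>1\<close> up to a factor tending to 1, so the B-limit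
  lies between \<open>p\<^sup>N\<^sup>+\<^sup>1 (1 - o(1))\<close> and \<open>p\<^sup>N\<close>; it is also asymptotic to \<open>s'(p\<^sub>0) (p - p\<^sub>0)\<close>, and comparing
  logarithms yields the formula for \<open>N\<close>. Replacing B by A after \<open>N\<close> changes the limit by only
  \<open>o(p\<^sup>N) = o(p - p\<^sub>0)\<close>, so \<open>s\<close> inherits the derivative of the B-limit at \<open>p\<^sub>0\<close>.
\<close>

section \<open>The recursion of strategy B\<close>

text \<open>
  \<open>near_all p k\<close> is the probability of at least \<open>k + 1\<close> heads among \<open>k + 2\<close> coins. Throughout, the
  index \<open>k\<close> stands for \<open>k + 1\<close> coins: \<open>B_seq p k\<close> is what \<open>s_seq (k + 1) p\<close> would be if strategy B were
  followed at every size.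
\<close>

definition near_all :: "real \<Rightarrow> nat \<Rightarrow> real" where
  "near_all p k = p ^ (k + 2) + real (k + 2) * p ^ (k + 1) * (1 - p)"

definition gain :: "real \<Rightarrow> nat \<Rightarrow> real" where
  "gain p k = p ^ (k + 2) * (1 - p) - (1 - p) ^ (k + 2)"

primrec B_seq :: "real \<Rightarrow> nat \<Rightarrow> real" where
  "B_seq p 0 = 0"
| "B_seq p (Suc k) = B_seq p k * (1 - near_all p k) + gain p k"

declare B_seq.simps(2) [simp del]

lemma near_all_factor: "near_all p k = p ^ (k + 1) * (p + real (k + 2) * (1 - p))"
  by (simp add: near_all_def algebra_simps)

lemma near_all_Suc: "near_all p k - near_all p (Suc k) = real (k + 2) * p ^ (k + 1) * (1 - p)^2"
  by (simp add: near_all_def algebra_simps power2_eq_square)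

lemma near_all_antimono:
  assumes "p \<in> {0..1}" "i \<le> k" shows "near_all p k \<le> near_all p i"
proof (rule lift_Suc_antimono_le[OF _ assms(2)])
  fix n
  have "0 \<le> real (n + 2) * p ^ (n + 1) * (1 - p)^2" using assms by simp
  then show "near_all p (Suc n) \<le> near_all p n" using near_all_Suc[of p n] by linarith
qed

lemma near_all_nonneg: "p \<in> {0..1} \<Longrightarrow> 0 \<le> near_all p k"
  by (simp add: near_all_def)

lemma near_all_le_1:
  assumes "p \<in> {0..1}" shows "near_all p k \<le> 1"
proof -
  have "near_all p 0 = 1 - (1 - p)^2" by (simp add: near_all_def power2_eq_square algebra_simps)
  then show ?thesis using near_all_antimono[OF assms, of 0 k] zero_le_power2[of "1 - p"] by linarith
qed

lemma near_all_le:
  assumes "p \<in> {0..5/8}" shows "near_all p k \<le> real (k + 2) * (5/8) ^ (k + 1)"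
proof -
  have "p + real (k + 2) * (1 - p) = real (k + 2) - p * real (k + 1)" by (simp add: algebra_simps)
  also have "\<dots> \<le> real (k + 2)" using assms by simp
  finally have "near_all p k \<le> p ^ (k + 1) * real (k + 2)"
    unfolding near_all_factor using assms by (intro mult_left_mono) auto
  also have "\<dots> \<le> (5/8) ^ (k + 1) * real (k + 2)"
    using assms by (intro mult_right_mono power_mono) auto
  finally show ?thesis by (simp add: mult.commute)
qed

text \<open>The quadratic factor has \<phi> as its positive root, so \<phi> is where
  \<open>s_seq 2 p\<close> changes sign; this is how \<phi> enters the theorem.\<close>

lemma B_seq_1: "B_seq p (Suc 0) = (1 - p) * (p^2 + p - 1)"
  by (simp add: B_seq.simps gain_def power2_eq_square power3_eq_cube algebra_simps)

text \<open>
  Up to the positive factor \<open>p ^ (k + 1)\<close>, the increment of \<open>B_seq\<close>. Its nonnegativity propagates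
  by itself as long as \<open>B_seq\<close> is nonpositive, because \<open>(1 - p) / p \<le> 1\<close>.
\<close>

definition B_slope :: "real \<Rightarrow> nat \<Rightarrow> real" where
  "B_slope p k = (1 - p) * (p - ((1 - p) / p) ^ (k + 1)) - B_seq p k * (p + real (k + 2) * (1 - p))"

lemma gain_factor:
  assumes "p \<noteq> 0" shows "gain p k = p ^ (k + 1) * ((1 - p) * (p - ((1 - p) / p) ^ (k + 1)))"
  using assms by (simp add: gain_def power_divide field_simps)

lemma B_seq_Suc_slope:
  assumes "p \<noteq> 0" shows "B_seq p (Suc k) = B_seq p k + p ^ (k + 1) * B_slope p k"
  unfolding B_slope_def B_seq.simps gain_factor[OF assms] near_all_factor
  by (simp add: algebra_simps)

text \<open>By \<open>B_seq_Suc_slope\<close>, the left side is the expression for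
  \<open>B_slope p (Suc k)\<close> with exponent and coefficient not yet advanced. Advancing them
  can only raise it, since \<open>(1 - p) / p \<le> 1\<close> and \<open>B_seq p (Suc k)\<close> is
  nonpositive.\<close>

lemma B_slope_Suc:
  assumes p: "p \<in> {1/2..1}" and b: "B_seq p (Suc k) \<le> 0"
  shows "B_slope p k * (1 - near_all p k) \<le> B_slope p (Suc k)"
proof -
  let ?r = "(1 - p) / p"
  have r: "0 \<le> ?r" "?r \<le> 1" using p by (auto simp: field_simps)
  have "?r ^ (Suc k + 1) \<le> ?r ^ (k + 1)" using r by (intro power_decreasing) auto
  then have 1: "(1 - p) * (p - ?r ^ (k + 1)) \<le> (1 - p) * (p - ?r ^ (Suc k + 1))"
    using p by (intro mult_left_mono) auto
  have "B_seq p (Suc k) * (1 - p) \<le> 0" using b p by (auto intro: mult_nonpos_nonneg)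
  then have 2: "B_seq p (Suc k) * (p + real (Suc k + 2) * (1 - p)) \<le>
      B_seq p (Suc k) * (p + real (k + 2) * (1 - p))"
    by (simp add: algebra_simps)
  have "B_slope p k * (1 - near_all p k) =
      B_slope p k - p ^ (k + 1) * B_slope p k * (p + real (k + 2) * (1 - p))"
    unfolding near_all_factor by (simp only: algebra_simps)
  also have "\<dots> = (1 - p) * (p - ?r ^ (k + 1)) -
      (B_seq p k + p ^ (k + 1) * B_slope p k) * (p + real (k + 2) * (1 - p))"
    unfolding B_slope_def[of p k] by (simp only: algebra_simps)
  also have "\<dots> = (1 - p) * (p - ?r ^ (k + 1)) - B_seq p (Suc k) * (p + real (k + 2) * (1 - p))"
    using B_seq_Suc_slope[of p k] p by simp
  finally have "B_slope p k * (1 - near_all p k) =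
      (1 - p) * (p - ?r ^ (k + 1)) - B_seq p (Suc k) * (p + real (k + 2) * (1 - p))" .
  with 1 2 show ?thesis unfolding B_slope_def[of p "Suc k"] by linarith
qed

text \<open>The induction on the slope starts at index 1, since \<open>B_slope p 0\<close> is
  negative for \<open>p < \<phi>\<close>. Multiplied by \<open>p ^ 2\<close>, the slope at 1 is a
  polynomial whose factors have a visible sign.\<close>

lemma B_slope_1_nonneg:
  assumes p: "p \<in> {1/2..1}" shows "0 \<le> B_slope p 1"
proof -
  have "p ^ 2 * B_slope p 1 = (1 - p) * (2 * p - 1) * (1 - p^2)^2"
  proof -
    have "p ^ 2 * B_slope p 1 = gain p 1 - B_seq p 1 * near_all p 1"
      using B_seq_Suc_slope[of p 1] p
      by (simp add: B_seq.simps(2)[of p "Suc 0"] algebra_simps power2_eq_square)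
    also have "\<dots> = (1 - p) * (2 * p - 1) * (1 - p^2)^2"
      by (simp add: gain_def near_all_def B_seq_1 eval_nat_numeral algebra_simps)
    finally show ?thesis .
  qed
  also have "\<dots> \<ge> 0" using p by simp
  finally show ?thesis using p by (simp add: zero_le_mult_iff)
qed

lemma B_slope_nonneg:
  assumes p: "p \<in> {1/2..1}"
  shows "(\<And>m. 1 \<le> m \<Longrightarrow> m \<le> Suc k \<Longrightarrow> B_seq p m \<le> 0) \<Longrightarrow> 0 \<le> B_slope p (Suc k)"
proof (induction k)
  case 0 then show ?case using B_slope_1_nonneg[OF p] by simp
next
  case (Suc k)
  have "0 \<le> B_slope p (Suc k)" by (rule Suc.IH) (use Suc.prems in auto)
  moreover have "near_all p (Suc k) \<le> 1" by (rule near_all_le_1) (use p in auto)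
  ultimately have "0 \<le> B_slope p (Suc k) * (1 - near_all p (Suc k))" by simp
  also have "\<dots> \<le> B_slope p (Suc (Suc k))" by (rule B_slope_Suc[OF p]) (use Suc.prems in auto)
  finally show ?case .
qed

lemma B_seq_incr:
  assumes p: "p \<in> {1/2..1}" and "1 \<le> k" "\<And>m. 1 \<le> m \<Longrightarrow> m \<le> k \<Longrightarrow> B_seq p m \<le> 0"
  shows "B_seq p k \<le> B_seq p (Suc k)"
proof -
  obtain j where j: "k = Suc j" using assms(2) by (cases k) auto
  have "0 \<le> B_slope p k" unfolding j by (rule B_slope_nonneg[OF p]) (use assms(3) j in auto)
  then show ?thesis using B_seq_Suc_slope[of p k] p by (auto intro!: mult_nonneg_nonneg simp: zero_le_mult_iff)
qed

text \<open>Monotonicity starts at index 1: from \<open>B_seq p 0 = 0\<close> the sequence first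
  drops to a negative value when \<open>p < \<phi>\<close>.\<close>

lemma B_seq_mono_nonpos:
  assumes p: "p \<in> {1/2..1}" and "1 \<le> i" "i \<le> k" "\<And>m. m < k \<Longrightarrow> B_seq p m \<le> 0"
  shows "B_seq p i \<le> B_seq p k"
  using assms(3,4)
proof (induction k rule: dec_induct)
  case (step n)
  have "B_seq p i \<le> B_seq p n" by (rule step.IH) (use step.prems in auto)
  also have "\<dots> \<le> B_seq p (Suc n)" by (rule B_seq_incr[OF p]) (use step assms(2) in auto)
  finally show ?case .
qed simp

text \<open>Damping keeps a nonpositive value nonpositive, so crossing zero takes a positive gain,
  and by \<open>gain_factor\<close> the sign of the gain is decided by this ratio.\<close>

lemma switch_ratio:
  assumes p: "p \<in> {1/2..<1}" and "B_seq p k \<le> 0" "0 < B_seq p (Suc k)"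
  shows "((1 - p) / p) ^ (k + 1) < p"
proof -
  have "B_seq p k * (1 - near_all p k) \<le> 0"
    using assms near_all_le_1[of p k] by (auto intro!: mult_nonpos_nonneg)
  then have "0 < gain p k" using assms(3) by (simp add: B_seq.simps)
  then have "0 < p ^ (k + 1) * ((1 - p) * (p - ((1 - p) / p) ^ (k + 1)))"
    using p by (simp add: gain_factor)
  moreover have "0 < p ^ (k + 1)" using p by simp
  ultimately have "0 < (1 - p) * (p - ((1 - p) / p) ^ (k + 1))" by (simp only: zero_less_mult_pos)
  moreover have "0 < 1 - p" using p by simp
  ultimately have "0 < p - ((1 - p) / p) ^ (k + 1)" by (simp only: zero_less_mult_pos)
  then show ?thesis by simp
qed

lemma gain_nonneg_after:
  assumes p: "p \<in> {1/2..<1}" and "((1 - p) / p) ^ (k + 1) < p" "k \<le> m"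
  shows "0 \<le> gain p m"
proof -
  have "((1 - p) / p) ^ (m + 1) \<le> ((1 - p) / p) ^ (k + 1)"
    using p assms(3) by (intro power_decreasing) (auto simp: field_simps)
  then have "0 \<le> p - ((1 - p) / p) ^ (m + 1)" using assms(2) by linarith
  moreover have "0 < p" "0 < 1 - p" using p by auto
  ultimately show ?thesis unfolding gain_factor[OF less_imp_neq[OF \<open>0 < p\<close>, symmetric]]
    by (intro mult_nonneg_nonneg zero_le_power) auto
qed

text \<open>Dropping the power of \<open>1 - p\<close> leaves a difference that telescopes when
  gains are summed.\<close>

lemma gain_le: "p \<in> {0..1} \<Longrightarrow> gain p k \<le> p ^ (k + 2) - p ^ (k + 3)"
  by (simp add: gain_def eval_nat_numeral right_diff_distrib)

lemma B_seq_Suc_le_gain: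
  assumes "p \<in> {0..1}" "B_seq p k \<le> 0" shows "B_seq p (Suc k) \<le> gain p k"
  unfolding B_seq.simps using assms near_all_le_1[of p k] by (auto intro!: mult_nonpos_nonneg)

text \<open>Supplies the gap condition with which \<open>A_regime\<close> starts at the switch. The
  left side is at most \<open>(1 - p) * ((1 - p) / p)\<close>, the right side at least
  \<open>(1 - p) * (1 - p ^ 3)\<close>.\<close>

lemma switch_dominates:
  assumes p: "p \<in> {544/1000..<1}" and b: "B_seq p k \<le> 0" "0 < B_seq p (Suc k)" and k: "1 \<le> k"
  shows "((1 - p) / p) ^ (k + 3) \<le> 1 - p - B_seq p (Suc k)"
proof -
  let ?r = "(1 - p) / p"
  have r: "?r ^ (k + 1) < p" using switch_ratio[of p k] p b by auto
  have "B_seq p (Suc k) \<le> gain p k" using B_seq_Suc_le_gain[of p k] p b by auto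
  also have "\<dots> \<le> p ^ 3 * (1 - p)"
  proof -
    have "p ^ (k + 2) \<le> p ^ 3" by (rule power_decreasing) (use p k in auto)
    then have "p ^ (k + 2) * (1 - p) \<le> p ^ 3 * (1 - p)" using p by (intro mult_right_mono) auto
    moreover have "0 \<le> (1 - p) ^ (k + 2)" using p by simp
    ultimately show ?thesis unfolding gain_def by linarith
  qed
  finally have 1: "(1 - p) * (1 - p ^ 3) \<le> 1 - p - B_seq p (Suc k)" by (simp add: algebra_simps)
  have "?r ^ (k + 3) = ?r ^ (k + 1) * ?r ^ 2" unfolding power_add[symmetric] by (simp add: eval_nat_numeral)
  also have "\<dots> \<le> p * ?r ^ 2" using r p by (intro mult_right_mono) auto
  also have "\<dots> = (1 - p) * ((1 - p) / p)" using p by (simp add: field_simps power2_eq_square)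
  also have "\<dots> \<le> (1 - p) * (1 - p ^ 3)"
  proof (rule mult_left_mono)
    \<comment> \<open>The comparison reduces to \<open>p^3 + p^2 + p \<ge> 1\<close>, with equality
      near 0.5437. This explains the bound 544/1000, which still lies below the zero of
      \<open>s\<close>.\<close>
    have "(544/1000)^3 \<le> p^3" "(544/1000)^2 \<le> p^2" using p by (auto intro!: power_mono)
    then have "0 \<le> p^3 + p^2 + p - 1" using p by (simp add: power_divide) 
    then have "0 \<le> (1 - p) * (p^3 + p^2 + p - 1)" using p by simp
    also have "\<dots> = 2 * p - 1 - p ^ 4" by (simp add: algebra_simps eval_nat_numeral)
    finally show "(1 - p) / p \<le> 1 - p ^ 3" using p by (simp add: field_simps eval_nat_numeral)
  qed (use p in auto)
  finally show ?thesis using 1 by simp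
qed

section \<open>Dependence on the parameter and the limit\<close>

definition near_all' :: "real \<Rightarrow> nat \<Rightarrow> real" where
  "near_all' p k = real (k + 2) * real (k + 1) * p ^ k * (1 - p)"

definition gain' :: "real \<Rightarrow> nat \<Rightarrow> real" where
  "gain' p k = real (k + 2) * p ^ (k + 1) - real (k + 3) * p ^ (k + 2) + real (k + 2) * (1 - p) ^ (k + 1)"

primrec B_seq' :: "real \<Rightarrow> nat \<Rightarrow> real" where
  "B_seq' p 0 = 0"
| "B_seq' p (Suc k) = B_seq' p k * (1 - near_all p k) - B_seq p k * near_all' p k + gain' p k"

declare B_seq'.simps(2) [simp del]

lemma has_derivative_near_all:
  "((\<lambda>p. near_all p k) has_real_derivative near_all' p k) (at p within S)"
  unfolding near_all_def near_all'_def
  by (rule derivative_eq_intros refl)+ (simp add: algebra_simps)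

lemma has_derivative_gain:
  "((\<lambda>p. gain p k) has_real_derivative gain' p k) (at p within S)"
  unfolding gain_def gain'_def
  by (rule derivative_eq_intros refl)+ (simp add: algebra_simps)

lemma has_derivative_B_seq:
  "((\<lambda>p. B_seq p k) has_real_derivative B_seq' p k) (at p within S)"
proof (induction k)
  case (Suc k)
  show ?case unfolding B_seq.simps B_seq'.simps
    by (rule DERIV_cong[OF DERIV_add[OF DERIV_mult[OF Suc
          DERIV_diff[OF DERIV_const has_derivative_near_all]] has_derivative_gain]])
       (simp add: algebra_simps)
qed simp

lemma isCont_B_seq: "isCont (\<lambda>p. B_seq p k) p"
  by (rule DERIV_isCont[OF has_derivative_B_seq])

lemma near_all'_nonneg: "p \<in> {0..1} \<Longrightarrow> 0 \<le> near_all' p k"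
  by (simp add: near_all'_def)

lemma gain'_pos:
  assumes "p \<in> {0<..5/8}" shows "0 < gain' p k"
proof -
  \<comment> \<open>The bound 5/8 is above \<phi>, yet small enough that
    \<open>(k + 3) * 5/8 < k + 2\<close> already at \<open>k = 0\<close>.\<close>
  have "real (k + 3) * p \<le> real (k + 3) * (5/8)" using assms by (intro mult_left_mono) auto
  also have "\<dots> < real (k + 2)" by simp
  finally have "0 < p ^ (k + 1) * (real (k + 2) - real (k + 3) * p)" using assms by simp
  moreover have "0 \<le> real (k + 2) * (1 - p) ^ (k + 1)" using assms by simp
  ultimately show ?thesis unfolding gain'_def by (simp add: algebra_simps)
qed

section \<open>Monotonicity in the parameter p\<close>

lemma near_all_mono:
  assumes "0 \<le> p" "p \<le> p'" "p' \<le> 1" shows "near_all p k \<le> near_all p' k"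
proof (rule DERIV_nonneg_imp_nondecreasing[OF assms(2)])
  fix x assume "p \<le> x" "x \<le> p'"
  then show "\<exists>y. ((\<lambda>p. near_all p k) has_real_derivative y) (at x) \<and> 0 \<le> y"
    using has_derivative_near_all near_all'_nonneg[of x k] assms by fastforce
qed

lemma gain_strict_mono:
  assumes "0 < p" "p < p'" "p' \<le> 5/8" shows "gain p k < gain p' k"
proof (rule DERIV_pos_imp_increasing[OF assms(2)])
  fix x assume "p \<le> x" "x \<le> p'"
  then show "\<exists>y. ((\<lambda>p. gain p k) has_real_derivative y) (at x) \<and> 0 < y"
    using has_derivative_gain gain'_pos[of x k] assms by fastforce
qed

lemma B_seq_le_in_p:
  assumes "0 < p" "p < p'" "p' \<le> 5/8" and "B_seq p k \<le> B_seq p' k" "B_seq p' k \<le> 0"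
  shows "B_seq p k * (1 - near_all p k) \<le> B_seq p' k * (1 - near_all p' k)"
proof -
  have "B_seq p k * (1 - near_all p k) \<le> B_seq p' k * (1 - near_all p k)"
    using assms near_all_le_1[of p k] by (intro mult_right_mono) auto
  also have "\<dots> \<le> B_seq p' k * (1 - near_all p' k)"
    using assms near_all_mono[of p p' k] by (intro mult_left_mono_neg) auto
  finally show ?thesis .
qed

text \<open>A larger parameter raises the gain, and it raises \<open>near_all\<close>, which pulls a
  nonpositive value closer to 0. The sign condition on \<open>p'\<close> passes to \<open>p\<close>
  through the inequality itself. Strictness starts at index 1 because index 0 is always 0.\<close>

lemma B_seq_strict_mono_in_p:
  assumes "0 < p" "p < p'" "p' \<le> 5/8" and "\<And>m. m < k \<Longrightarrow> B_seq p' m \<le> 0"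
  shows "B_seq p k \<le> B_seq p' k \<and> (1 \<le> k \<longrightarrow> B_seq p k < B_seq p' k)"
  using assms(4)
proof (induction k)
  case (Suc k)
  then have "B_seq p k \<le> B_seq p' k" "B_seq p' k \<le> 0" by auto
  from B_seq_le_in_p[OF assms(1-3) this] gain_strict_mono[OF assms(1-3), of k]
  show ?case by (simp add: B_seq.simps)
qed simp

text \<open>Brings the difference of two parameters into the form required by
  \<open>damped_limit_pos\<close>.\<close>

lemma B_seq_diff_damped:
  assumes "0 < p" "p < p'" "p' \<le> 5/8" and "\<And>m. m \<le> k \<Longrightarrow> B_seq p' m \<le> 0"
  shows "(B_seq p' k - B_seq p k) * (1 - near_all p' k) \<le> B_seq p' (Suc k) - B_seq p (Suc k)"
proof -
  have b: "B_seq p k \<le> B_seq p' k" using B_seq_strict_mono_in_p[of p p' k] assms by auto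
  with assms(4)[of k] have "B_seq p k \<le> 0" by simp
  then have "B_seq p k * (1 - near_all p k) \<le> B_seq p k * (1 - near_all p' k)"
    using assms near_all_mono[of p p' k] by (intro mult_left_mono_neg) auto
  then show ?thesis using gain_strict_mono[OF assms(1-3), of k]
    by (simp add: B_seq.simps algebra_simps)
qed

text \<open>A common summable majorant, uniform in p, for \<open>near_all\<close>,
  \<open>near_all'\<close> and, up to a factor 2, \<open>gain'\<close>. The square absorbs the two
  linear factors of \<open>near_all'\<close>.\<close>

definition weight :: "nat \<Rightarrow> real" where "weight k = real (k + 2) ^ 2 * (5/8) ^ k"

lemma weight_nonneg: "0 \<le> weight k" by (simp add: weight_def)

lemma summable_weight: "summable weight"
proof (rule summable_comparison_test_bigo)
  show "summable (\<lambda>n. norm ((3/4::real) ^ n))" by (simp add: summable_geometric)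
  show "weight \<in> O(\<lambda>n. (3/4) ^ n)" unfolding weight_def by real_asymp
qed

definition weight_tail :: "nat \<Rightarrow> real" where "weight_tail K = (\<Sum>i. weight (i + K))"

lemma weight_tail_tendsto_0: "weight_tail \<longlonglongrightarrow> 0"
proof -
  have "(\<lambda>K. suminf weight - sum weight {..<K}) \<longlonglongrightarrow> suminf weight - suminf weight"
    by (intro tendsto_intros summable_LIMSEQ summable_weight)
  then show ?thesis
    by (simp add: weight_tail_def[abs_def] suminf_minus_initial_segment[OF summable_weight])
qed

lemma weight_tail_nonneg: "0 \<le> weight_tail K"
  unfolding weight_tail_def
  by (intro suminf_nonneg) (auto simp: weight_nonneg summable_weight)

lemma sum_weight_le_tail: "(\<Sum>i = K..<n. weight i) \<le> weight_tail K"
proof (cases "K \<le> n")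
  case True
  have "(\<Sum>i = K..<n. weight i) = (\<Sum>i<n - K. weight (i + K))"
    using sum.shift_bounds_nat_ivl[of weight 0 K "n - K"] True by (simp add: atLeast0LessThan)
  also have "\<dots> \<le> weight_tail K"
    unfolding weight_tail_def by (intro sum_le_suminf) (auto simp: weight_nonneg summable_weight)
  finally show ?thesis .
qed (simp add: weight_tail_nonneg)

lemma near_all_le_weight:
  assumes "p \<in> {0..5/8}" shows "near_all p k \<le> weight k"
proof -
  have "real (k + 2) * (5/8) ^ (k + 1) \<le> weight k"
    unfolding weight_def power2_eq_square mult.assoc
    by (intro mult_left_mono) (auto simp: field_simps)
  with near_all_le[OF assms, of k] show ?thesis by linarith
qed

lemma near_all_less_1:
  assumes "p \<in> {0..<1}" shows "near_all p k < 1"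
proof -
  have "near_all p 0 = 1 - (1 - p)^2" by (simp add: near_all_def power2_eq_square algebra_simps)
  moreover have "0 < (1 - p)^2" using assms by simp
  moreover have "near_all p k \<le> near_all p 0" using assms by (intro near_all_antimono) auto
  ultimately show ?thesis by linarith
qed

text \<open>The product of the factors \<open>1 - near_all p i\<close> from K on is at least 1 minus
  the sum of the weights, hence at least 1/2 once the tail is small. So y stays above half of its
  positive value at K.\<close>

lemma damped_limit_pos:
  assumes p: "p \<in> {0..5/8}" and pos: "0 < y m"
    and step: "\<And>k. m \<le> k \<Longrightarrow> y k * (1 - near_all p k) \<le> y (Suc k)"
    and lim: "y \<longlonglongrightarrow> l"
  shows "0 < (l::real)"
proof -
  have ypos: "0 < y k" if "m \<le> k" for k
    using that
  proof (induction k rule: dec_induct)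
    case (step k)
    have "near_all p k < 1" using near_all_less_1[of p k] p by auto
    then have "0 < y k * (1 - near_all p k)" using step by simp
    then show ?case using assms(3)[of k] step by auto
  qed (rule pos)
  have "eventually (\<lambda>K. weight_tail K < 1/2) sequentially"
    using weight_tail_tendsto_0 by (rule order_tendstoD) simp
  then obtain K0 where K0: "\<And>K. K0 \<le> K \<Longrightarrow> weight_tail K < 1/2"
    by (auto simp: eventually_sequentially)
  define K where "K = max K0 m"
  have K: "weight_tail K < 1/2" "m \<le> K" using K0[of K] by (auto simp: K_def)
  have "y K * (1 - (\<Sum>i = K..<n. weight i)) \<le> y n" if "K \<le> n" for n
    using that
  proof (induction n rule: dec_induct)
    case (step n)
    let ?S = "\<Sum>i = K..<n. weight i"
    have S: "0 \<le> ?S" by (intro sum_nonneg weight_nonneg)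
    have nn: "0 \<le> near_all p n" "near_all p n \<le> weight n" "near_all p n \<le> 1"
      using p near_all_nonneg[of p n] near_all_le_weight[OF p, of n] near_all_le_1[of p n] by auto
    have "1 - (?S + weight n) \<le> (1 - ?S) * (1 - near_all p n)"
      using nn mult_nonneg_nonneg[OF S nn(1)] by (simp add: algebra_simps)
    then have "y K * (1 - (?S + weight n)) \<le> y K * ((1 - ?S) * (1 - near_all p n))"
      using ypos[of K] K by (intro mult_left_mono) auto
    also have "\<dots> = (y K * (1 - ?S)) * (1 - near_all p n)" by simp
    also have "\<dots> \<le> y n * (1 - near_all p n)" using step nn by (intro mult_right_mono) auto
    also have "\<dots> \<le> y (Suc n)" using assms(3)[of n] step K by auto
    finally show ?case using step by simp
  qed simp
  moreover have "y K * (1/2) \<le> y K * (1 - (\<Sum>i = K..<n. weight i))" for n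
    using ypos[of K] K sum_weight_le_tail[of K n] by (intro mult_left_mono) auto
  ultimately have "y K * (1/2) \<le> l"
    using lim by (intro LIMSEQ_le_const[OF lim] exI[of _ K]) (meson order_trans)
  then show ?thesis using ypos[of K] K by simp
qed

lemma abs_gain_le:
  assumes "p \<in> {1/2..5/8}" shows "\<bar>gain p k\<bar> \<le> (5/8) ^ (k + 2)"
proof -
  have 1: "p ^ (k + 2) \<le> (5/8) ^ (k + 2)" "(1 - p) ^ (k + 2) \<le> (5/8) ^ (k + 2)"
    by (rule power_mono; use assms in simp)+
  have 2: "0 \<le> p ^ (k + 2) * (1 - p)" "0 \<le> (1 - p) ^ (k + 2)" using assms by auto
  have "p ^ (k + 2) * (1 - p) \<le> p ^ (k + 2)" using assms by (simp add: mult_le_cancel_left1)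
  with 1 2 show ?thesis unfolding gain_def abs_le_iff by linarith
qed

text \<open>Damping does not enlarge the absolute value, so only the geometrically small gains
  accumulate. The subtracted power is the room that closes the induction.\<close>

lemma abs_B_seq_le:
  assumes p: "p \<in> {1/2..5/8}" shows "\<bar>B_seq p k\<bar> \<le> 2 - 2 * (5/8) ^ k"
proof (induction k)
  case (Suc k)
  have "\<bar>B_seq p k * (1 - near_all p k)\<bar> \<le> \<bar>B_seq p k\<bar>"
    using p near_all_nonneg[of p k] near_all_le_1[of p k]
    by (auto simp: abs_mult intro!: mult_left_le)
  then have "\<bar>B_seq p (Suc k)\<bar> \<le> 2 - 2 * (5/8) ^ k + (5/8) ^ (k + 2)"
    using abs_gain_le[OF p, of k] Suc by (simp add: B_seq.simps)
  also have "\<dots> \<le> 2 - 2 * (5/8) ^ Suc k" by (simp add: field_simps)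
  finally show ?case .
qed simp

lemma abs_B_seq_le_2:
  assumes "p \<in> {1/2..5/8}" shows "\<bar>B_seq p k\<bar> \<le> 2"
proof -
  have "0 \<le> (5/8::real) ^ k" by simp
  with abs_B_seq_le[OF assms, of k] show ?thesis by linarith
qed

lemma near_all'_le_weight:
  assumes "p \<in> {1/2..5/8}" shows "near_all' p k \<le> weight k"
proof -
  have "p ^ k * (1 - p) \<le> (5/8) ^ k * 1"
    using assms by (intro mult_mono power_mono) auto
  moreover have "0 \<le> p ^ k * (1 - p)" using assms by simp
  ultimately have "real (k + 2) * real (k + 1) * (p ^ k * (1 - p)) \<le>
      real (k + 2) * real (k + 2) * ((5/8) ^ k * 1)"
    by (intro mult_mono[OF mult_left_mono]) simp_all
  then show ?thesis by (simp add: near_all'_def weight_def power2_eq_square mult.assoc)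
qed

lemma abs_gain'_le_weight:
  assumes "p \<in> {1/2..5/8}" shows "\<bar>gain' p k\<bar> \<le> 2 * weight k"
proof -
  have pw: "p ^ (k + 1) \<le> (5/8) ^ k" "(1 - p) ^ (k + 1) \<le> (5/8) ^ k"
    by (rule order_trans[OF power_mono[of _ "5/8" "k + 1"] power_decreasing[of k "k + 1"]];
        use assms in simp)+
  have w: "real (k + 2) * (5/8) ^ k \<le> weight k"
    unfolding weight_def power2_eq_square by (intro mult_right_mono) auto
  have "real (k + 2) * p ^ (k + 1) \<le> weight k" "real (k + 2) * (1 - p) ^ (k + 1) \<le> weight k"
    by (rule order_trans[OF mult_left_mono w]; use pw in simp)+
  moreover have "0 \<le> real (k + 3) * p ^ (k + 2)" using assms by simp
  moreover have "0 < gain' p k" using assms by (intro gain'_pos) auto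
  ultimately show ?thesis unfolding gain'_def by linarith
qed

text \<open>The factor 4 collects 2 from the bound on \<open>B_seq\<close> in front of
  \<open>near_all'\<close> and 2 from \<open>abs_gain'_le_weight\<close>.\<close>

lemma abs_B_seq'_le:
  assumes p: "p \<in> {1/2..5/8}" shows "\<bar>B_seq' p k\<bar> \<le> 4 * (\<Sum>i = 0..<k. weight i)"
proof (induction k)
  case (Suc k)
  have "\<bar>B_seq' p k * (1 - near_all p k)\<bar> \<le> \<bar>B_seq' p k\<bar>"
    using p near_all_nonneg[of p k] near_all_le_1[of p k]
    by (auto simp: abs_mult intro!: mult_left_le)
  moreover have "\<bar>B_seq p k * near_all' p k\<bar> \<le> 2 * weight k"
    unfolding abs_mult using p abs_B_seq_le_2[OF p, of k] near_all'_nonneg[of p k] near_all'_le_weight[OF p, of k]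
    by (intro mult_mono) auto
  ultimately show ?case using abs_gain'_le_weight[OF p, of k] Suc by (simp add: B_seq'.simps)
qed simp

lemma abs_B_seq_step_le:
  assumes p: "p \<in> {1/2..5/8}" shows "\<bar>B_seq p (Suc k) - B_seq p k\<bar> \<le> 3 * weight k"
proof -
  have "\<bar>B_seq p k * near_all p k\<bar> \<le> 2 * weight k"
    unfolding abs_mult using p abs_B_seq_le_2[OF p, of k] near_all_nonneg[of p k] near_all_le_weight[of p k]
    by (intro mult_mono) auto
  moreover have "\<bar>gain p k\<bar> \<le> weight k"
  proof -
    have "(5/8::real) ^ (k + 2) \<le> 1 * (5/8) ^ k" by simp
    also have "\<dots> \<le> weight k" unfolding weight_def by (intro mult_right_mono) auto
    finally show ?thesis using abs_gain_le[OF p, of k] by simp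
  qed
  ultimately show ?thesis by (simp add: B_seq.simps algebra_simps)
qed

lemma abs_B_seq'_step_le:
  assumes p: "p \<in> {1/2..5/8}"
  shows "\<bar>B_seq' p (Suc k) - B_seq' p k\<bar> \<le> (4 * weight_tail 0 + 4) * weight k"
proof -
  have "\<bar>B_seq' p k\<bar> \<le> 4 * weight_tail 0"
    using abs_B_seq'_le[OF p, of k] sum_weight_le_tail[of 0 k] by simp
  then have "\<bar>B_seq' p k * near_all p k\<bar> \<le> 4 * weight_tail 0 * weight k"
    unfolding abs_mult using p near_all_nonneg[of p k] near_all_le_weight[of p k] weight_tail_nonneg[of 0]
    by (intro mult_mono) auto
  moreover have "\<bar>B_seq p k * near_all' p k\<bar> \<le> 2 * weight k"
    unfolding abs_mult using p abs_B_seq_le_2[OF p, of k] near_all'_nonneg[of p k] near_all'_le_weight[OF p, of k]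
    by (intro mult_mono) auto
  ultimately show ?thesis using abs_gain'_le_weight[OF p, of k] by (simp add: B_seq'.simps algebra_simps)
qed

text \<open>Written as a series of increments so that term-by-term differentiation applies;
  \<open>B_seq_tendsto\<close> identifies it with the limit of \<open>B_seq p\<close>.\<close>

definition B_lim :: "real \<Rightarrow> real" where
  "B_lim p = (\<Sum>k. B_seq p (Suc k) - B_seq p k)"

lemma B_seq_tendsto:
  assumes "p \<in> {1/2..5/8}" shows "B_seq p \<longlonglongrightarrow> B_lim p"
proof -
  have "summable (\<lambda>k. B_seq p (Suc k) - B_seq p k)"
    by (rule summable_comparison_test'[OF summable_mult[OF summable_weight, of 3], of 0])
       (use abs_B_seq_step_le[OF assms] in auto)
  then have "(\<lambda>n. \<Sum>k<n. B_seq p (Suc k) - B_seq p k) \<longlonglongrightarrow> B_lim p"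
    unfolding B_lim_def by (rule summable_LIMSEQ)
  then show ?thesis by (simp add: sum_lessThan_telescope)
qed

text \<open>The increments of \<open>B_seq'\<close> are bounded by a multiple of
  \<open>weight\<close> uniformly in p, so the Weierstrass test applies. The second claim presents
  the derivative as a limit, ready for \<open>damped_limit_pos\<close>.\<close>

lemma B_lim_differentiable:
  assumes "p \<in> {1/2<..<5/8}"
  shows "(B_lim has_real_derivative (\<Sum>k. B_seq' p (Suc k) - B_seq' p k)) (at p)" (is ?D)
    and "B_seq' p \<longlonglongrightarrow> (\<Sum>k. B_seq' p (Suc k) - B_seq' p k)"
proof -
  let ?I = "{1/2..5/8::real}"
  have M: "summable (\<lambda>k. (4 * weight_tail 0 + 4) * weight k)"
    by (intro summable_mult summable_weight)
  show ?D unfolding B_lim_def[abs_def]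
  proof (rule has_field_derivative_series'(2)[where S = ?I and x0 = p])
    show "uniformly_convergent_on ?I (\<lambda>n x. \<Sum>i<n. B_seq' x (Suc i) - B_seq' x i)"
      by (rule Weierstrass_m_test'[OF _ M]) (use abs_B_seq'_step_le in auto)
    show "summable (\<lambda>k. B_seq p (Suc k) - B_seq p k)"
      by (rule summable_comparison_test'[OF summable_mult[OF summable_weight, of 3], of 0])
         (use abs_B_seq_step_le[of p] assms in auto)
  qed (use assms in \<open>auto intro!: has_derivative_B_seq derivative_intros simp: interior_atLeastAtMost_real\<close>)
  have "summable (\<lambda>k. B_seq' p (Suc k) - B_seq' p k)"
    by (rule summable_comparison_test'[OF M, of 0]) (use abs_B_seq'_step_le[of p] assms in auto)
  then have "(\<lambda>n. \<Sum>k<n. B_seq' p (Suc k) - B_seq' p k) \<longlonglongrightarrow> (\<Sum>k. B_seq' p (Suc k) - B_seq' p k)"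
    by (rule summable_LIMSEQ)
  then show "B_seq' p \<longlonglongrightarrow> (\<Sum>k. B_seq' p (Suc k) - B_seq' p k)"
    by (simp add: sum_lessThan_telescope)
qed

text \<open>While \<open>B_seq p\<close> is nonpositive, both source terms in the recursion of
  \<open>B_seq'\<close> help: \<open>gain'\<close> is positive and
  \<open>- B_seq p k * near_all' p k\<close> is nonnegative. So \<open>B_seq'\<close> is positive
  from index 1 on and only damped.\<close>

lemma B_lim_deriv_pos:
  assumes p: "p \<in> {1/2<..<5/8}" and neg: "\<And>k. B_seq p k \<le> 0"
  obtains D where "(B_lim has_real_derivative D) (at p)" "0 < D"
proof
  show "(B_lim has_real_derivative (\<Sum>k. B_seq' p (Suc k) - B_seq' p k)) (at p)"
    by (rule B_lim_differentiable[OF p])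
  show "0 < (\<Sum>k. B_seq' p (Suc k) - B_seq' p k)"
  proof (rule damped_limit_pos[where p = p and y = "B_seq' p" and m = 1])
    have "0 < gain' p k" for k by (rule gain'_pos) (use p in auto)
    moreover have "0 \<le> - (B_seq p k * near_all' p k)" for k
      using neg[of k] near_all'_nonneg[of p k] p by (auto intro!: mult_nonpos_nonneg)
    ultimately have "B_seq' p k * (1 - near_all p k) < B_seq' p (Suc k)" for k
      unfolding B_seq'.simps by (smt (verit))
    from this this[of 0] show "0 < B_seq' p 1"
      "\<And>k. B_seq' p k * (1 - near_all p k) \<le> B_seq' p (Suc k)" by (auto intro: less_imp_le)
  qed (use p B_lim_differentiable(2)[OF p] in auto)
qed

text \<open>The ratio bound at the switch keeps every later gain nonnegative, and the damping factor
  is positive.\<close>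

lemma B_seq_pos_after:
  assumes p: "p \<in> {1/2..<1}" and b: "B_seq p k \<le> 0" "0 < B_seq p (Suc k)" and "Suc k \<le> m"
  shows "0 < B_seq p m" "B_seq p m * (1 - near_all p m) \<le> B_seq p (Suc m)"
proof -
  have g: "0 \<le> gain p m" if "k \<le> m" for m
    by (rule gain_nonneg_after[OF p switch_ratio[OF p b] that])
  show "B_seq p m * (1 - near_all p m) \<le> B_seq p (Suc m)"
    using g[of m] assms(4) by (simp add: B_seq.simps)
  show "0 < B_seq p m" using assms(4)
  proof (induction m rule: dec_induct)
    case (step n)
    then have "0 < B_seq p n * (1 - near_all p n)" using near_all_less_1[of p n] p by simp
    then show ?case using g[of n] step by (simp add: B_seq.simps)
  qed (rule b)
qed

text \<open>Index \<open>switch p\<close> stands for \<open>switch p + 1\<close> coins, which is the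
  N of the theorem. The value is meaningful only when some \<open>B_seq p m\<close> is
  positive.\<close>

definition switch :: "real \<Rightarrow> nat" where "switch p = (LEAST m. 0 < B_seq p m)"

lemma switch_cases:
  assumes "0 < B_seq p n"
  obtains k where "switch p = Suc k" "\<And>m. m \<le> k \<Longrightarrow> B_seq p m \<le> 0" "0 < B_seq p (Suc k)"
proof -
  have pos: "0 < B_seq p (switch p)" unfolding switch_def by (rule LeastI[of _ n]) (rule assms)
  then obtain k where k: "switch p = Suc k" by (cases "switch p") auto
  have "B_seq p m \<le> 0" if "m \<le> k" for m
    using not_less_Least[of m "\<lambda>m. 0 < B_seq p m"] that k by (auto simp: switch_def[symmetric])
  then show thesis using that[of k] k pos by simp
qed

text \<open>Once positive, the sequence is only damped. The contrapositive is used at the zero of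
  \<open>B_lim\<close>, where the whole sequence must be nonpositive.\<close>

lemma B_lim_pos:
  assumes p: "p \<in> {1/2..5/8}" and "0 < B_seq p n"
  shows "0 < B_lim p"
proof -
  obtain k where k: "\<And>m. m \<le> k \<Longrightarrow> B_seq p m \<le> 0" "0 < B_seq p (Suc k)"
    using switch_cases[OF assms(2)] by metis
  show ?thesis
    by (rule damped_limit_pos[of p "B_seq p" "Suc k"])
       (use p k B_seq_pos_after[of p k] B_seq_tendsto[OF p] in auto)
qed

text \<open>The difference of the two sequences is positive at index 1 and then only damped. This
  gives the negative sign of \<open>s\<close> below the zero and the existence of a switch above
  it.\<close>

lemma B_lim_strict_mono:
  assumes "1/2 \<le> p" "p < p'" "p' \<le> 5/8" and neg: "\<And>k. B_seq p' k \<le> 0"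
  shows "B_lim p < B_lim p'"
proof -
  have "0 < B_lim p' - B_lim p"
  proof (rule damped_limit_pos[where p = p' and y = "\<lambda>k. B_seq p' k - B_seq p k" and m = 1])
    show "0 < B_seq p' 1 - B_seq p 1"
      using B_seq_strict_mono_in_p[of p p' 1] assms by auto
  qed (use assms in \<open>auto intro!: tendsto_intros B_seq_tendsto B_seq_diff_damped\<close>)
  then show ?thesis by simp
qed

section \<open>Numerical enclosure of the zero\<close>

text \<open>
  Fixed-point enclosures with outward rounding. A list entry \<open>(x, y, z)\<close> approximates
  \<open>p ^ (k + 1)\<close>, \<open>(1 - p) ^ (k + 1)\<close> and \<open>B_seq p k\<close>, each multiplied by \<open>scale\<close>; the argument \<open>i\<close>
  of a certificate is \<open>k + 2\<close>. The entries were computed outside the logic and are only checked here.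
\<close>

definition scale :: int where "scale = 1000000000000000000"

lemma scale_pos: "0 < real_of_int scale" by (simp add: scale_def)

text \<open>One step of \<open>B_seq\<close> with denominators cleared: \<open>z\<close> already
  carries one factor \<open>scale\<close>, and two more are multiplied in.\<close>

definition cert_step :: "int \<Rightarrow> int \<Rightarrow> int \<Rightarrow> int \<Rightarrow> int \<Rightarrow> int \<Rightarrow> int" where
  "cert_step P i x x' y' z = z * scale * scale - z * (x' * scale + i * x * (scale - P)) +
     (x' * (scale - P) - y' * scale) * scale"

text \<open>The test \<open>z \<le> 0\<close> fixes the direction of rounding: for such z, rounding
  x down lowers both the gain and \<open>- z * near_all\<close>, while y enters negatively and is
  rounded up.\<close>

fun lower_cert :: "int \<Rightarrow> int \<Rightarrow> int \<Rightarrow> int \<Rightarrow> int \<Rightarrow> (int \<times> int \<times> int) list \<Rightarrow> bool" where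
  "lower_cert P i x y z [] \<longleftrightarrow> 0 < z"
| "lower_cert P i x y z ((x', y', z') # cs) \<longleftrightarrow> z \<le> 0 \<and> x' * scale \<le> x * P \<and>
     y * (scale - P) \<le> y' * scale \<and> z' * scale * scale \<le> cert_step P i x x' y' z \<and>
     lower_cert P (i + 1) x' y' z' cs"

fun upper_cert :: "int \<Rightarrow> int \<Rightarrow> int \<Rightarrow> int \<Rightarrow> int \<Rightarrow> (int \<times> int \<times> int) list \<Rightarrow> bool" where
  "upper_cert P i x y z [] \<longleftrightarrow> z \<le> - 2 * x"
| "upper_cert P i x y z ((x', y', z') # cs) \<longleftrightarrow> z \<le> 0 \<and> x * P \<le> x' * scale \<and>
     y' * scale \<le> y * (scale - P) \<and> cert_step P i x x' y' z \<le> z' * scale * scale \<and>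
     upper_cert P (i + 1) x' y' z' cs"

context
  fixes P :: int and p :: real
  assumes P: "real_of_int P = real_of_int scale * p" and p: "p \<in> {0..1}"
begin

lemma cert_step_real:
  "real_of_int (cert_step P i x x' y' z) = real_of_int scale ^ 2 *
     (z - z * (x' / scale + i * (x / scale) * (1 - p)) + x' * (1 - p) - y')"
  using scale_pos by (simp add: cert_step_def P field_simps power2_eq_square)

lemma B_seq_step_lower:
  assumes z: "z \<le> 0" and b: "z \<le> S * B_seq p k" and x: "x \<le> p ^ (k + 1)" "x' \<le> p ^ (k + 2)"
    and y: "(1 - p) ^ (k + 2) \<le> y'" and S: "0 < S"
  shows "z - z * (x' + real (k + 2) * x * (1 - p)) + S * x' * (1 - p) - S * y' \<le> S * B_seq p (Suc k)"
proof -
  have "real (k + 2) * x * (1 - p) \<le> real (k + 2) * p ^ (k + 1) * (1 - p)"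
    using p x by (intro mult_right_mono mult_left_mono) auto
  then have "x' + real (k + 2) * x * (1 - p) \<le> near_all p k"
    using x unfolding near_all_def by linarith
  then have "- z * (x' + real (k + 2) * x * (1 - p)) \<le> - z * near_all p k"
    using z by (intro mult_left_mono) auto
  moreover have "z * (1 - near_all p k) \<le> S * B_seq p k * (1 - near_all p k)"
    using b near_all_le_1[OF p, of k] by (intro mult_right_mono) auto
  moreover have "S * (x' * (1 - p) - y') \<le> S * gain p k"
  proof (rule mult_left_mono)
    have "x' * (1 - p) \<le> p ^ (k + 2) * (1 - p)" using x p by (intro mult_right_mono) auto
    then show "x' * (1 - p) - y' \<le> gain p k" unfolding gain_def using y by linarith
  qed (use S in simp)
  ultimately show ?thesis by (simp add: B_seq.simps algebra_simps)
qed

lemma B_seq_step_upper: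
  assumes z: "z \<le> 0" and b: "S * B_seq p k \<le> z" and x: "p ^ (k + 1) \<le> x" "p ^ (k + 2) \<le> x'"
    and y: "y' \<le> (1 - p) ^ (k + 2)" and S: "0 < S"
  shows "S * B_seq p (Suc k) \<le> z - z * (x' + real (k + 2) * x * (1 - p)) + S * x' * (1 - p) - S * y'"
proof -
  have "real (k + 2) * p ^ (k + 1) * (1 - p) \<le> real (k + 2) * x * (1 - p)"
    using p x by (intro mult_right_mono mult_left_mono) auto
  then have "near_all p k \<le> x' + real (k + 2) * x * (1 - p)"
    using x unfolding near_all_def by linarith
  then have "- z * near_all p k \<le> - z * (x' + real (k + 2) * x * (1 - p))"
    using z by (intro mult_left_mono) auto
  moreover have "S * B_seq p k * (1 - near_all p k) \<le> z * (1 - near_all p k)"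
    using b near_all_le_1[OF p, of k] by (intro mult_right_mono) auto
  moreover have "S * gain p k \<le> S * (x' * (1 - p) - y')"
  proof (rule mult_left_mono)
    have "p ^ (k + 2) * (1 - p) \<le> x' * (1 - p)" using x p by (intro mult_right_mono) auto
    then show "gain p k \<le> x' * (1 - p) - y'" unfolding gain_def using y by linarith
  qed (use S in simp)
  ultimately show ?thesis by (simp add: B_seq.simps algebra_simps)
qed

lemma lower_cert_sound:
  "lower_cert P i x y z cs \<Longrightarrow> i = int (k + 2) \<Longrightarrow> x / scale \<le> p ^ (k + 1) \<Longrightarrow>
    (1 - p) ^ (k + 1) \<le> y / scale \<Longrightarrow> z / scale \<le> B_seq p k \<Longrightarrow> 0 < B_seq p (k + length cs)"
proof (induction cs arbitrary: i x y z k)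
  case Nil
  then have "0 < real_of_int z / scale" using scale_pos by simp
  with Nil show ?case by simp
next
  case (Cons c cs)
  obtain x' y' z' where c: "c = (x', y', z')" by (cases c) auto
  let ?S = "real_of_int scale"
  have h: "z \<le> 0" "x' * scale \<le> x * P" "y * (scale - P) \<le> y' * scale"
    "z' * scale * scale \<le> cert_step P i x x' y' z" "lower_cert P (i + 1) x' y' z' cs"
    using Cons.prems(1) by (auto simp: c)
  have "real_of_int (x' * scale) \<le> of_int (x * P)" using h by (simp only: of_int_le_iff)
  then have x1: "x' / ?S \<le> x / ?S * p" using scale_pos by (simp add: P field_simps)
  also have "\<dots> \<le> p ^ (k + 1) * p" using Cons.prems(3) p by (intro mult_right_mono) auto
  finally have x': "x' / ?S \<le> p ^ (k + 2)" by (simp add: mult_ac)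
  have "real_of_int (y * (scale - P)) \<le> of_int (y' * scale)" using h by (simp only: of_int_le_iff)
  then have y1: "y / ?S * (1 - p) \<le> y' / ?S" using scale_pos by (simp add: P field_simps)
  have "(1 - p) ^ (k + 2) = (1 - p) ^ (k + 1) * (1 - p)" by simp
  also have "\<dots> \<le> y / ?S * (1 - p)" using Cons.prems(4) p by (intro mult_right_mono) auto
  finally have y': "(1 - p) ^ (k + 2) \<le> y' / ?S" using y1 by linarith
  have "real_of_int (z' * scale * scale) \<le> real_of_int (cert_step P i x x' y' z)" using h by (simp only: of_int_le_iff)
  then have "?S^2 * z' \<le> ?S^2 * (z - z * (x' / scale + i * (x / scale) * (1 - p)) + x' * (1 - p) - y')"
    unfolding cert_step_real by (simp add: power2_eq_square mult_ac)
  then have "z' \<le> z - z * (x' / scale + i * (x / scale) * (1 - p)) + x' * (1 - p) - y'"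
    using scale_pos by (simp only: mult_le_cancel_left_pos zero_less_power)
  also have "\<dots> = z - z * (x' / ?S + real (k + 2) * (x / ?S) * (1 - p)) + ?S * (x' / ?S) * (1 - p) - ?S * (y' / ?S)"
    using scale_pos Cons.prems(2) by simp
  also have "\<dots> \<le> ?S * B_seq p (Suc k)"
    by (rule B_seq_step_lower) (use h(1) Cons.prems x' y' scale_pos in \<open>auto simp: field_simps\<close>)
  finally have "z' / ?S \<le> B_seq p (Suc k)" using scale_pos by (simp add: field_simps)
  from Cons.IH[OF h(5) _ _ _ this] x' y' Cons.prems(2) show ?case by simp
qed

lemma upper_cert_sound:
  "upper_cert P i x y z cs \<Longrightarrow> i = int (k + 2) \<Longrightarrow> p ^ (k + 1) \<le> x / scale \<Longrightarrow>
    y / scale \<le> (1 - p) ^ (k + 1) \<Longrightarrow> B_seq p k \<le> z / scale \<Longrightarrow>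
    (\<forall>m. k \<le> m \<and> m < k + length cs \<longrightarrow> B_seq p m \<le> 0) \<and>
    B_seq p (k + length cs) \<le> - 2 * p ^ (k + length cs + 1)"
proof (induction cs arbitrary: i x y z k)
  case Nil
  then have "z / real_of_int scale \<le> (- 2 * x) / scale"
    using scale_pos by (intro divide_right_mono) auto
  also have "\<dots> \<le> - 2 * p ^ (k + 1)" using Nil by simp
  finally show ?case using Nil by simp
next
  case (Cons c cs)
  obtain x' y' z' where c: "c = (x', y', z')" by (cases c) auto
  let ?S = "real_of_int scale"
  have h: "z \<le> 0" "x * P \<le> x' * scale" "y' * scale \<le> y * (scale - P)"
    "cert_step P i x x' y' z \<le> z' * scale * scale" "upper_cert P (i + 1) x' y' z' cs"
    using Cons.prems(1) by (auto simp: c)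
  have "real_of_int (x * P) \<le> of_int (x' * scale)" using h by (simp only: of_int_le_iff)
  then have x1: "x / ?S * p \<le> x' / ?S" using scale_pos by (simp add: P field_simps)
  have "p ^ (k + 2) = p ^ (k + 1) * p" by simp
  also have "\<dots> \<le> x / ?S * p" using Cons.prems(3) p by (intro mult_right_mono) auto
  finally have x': "p ^ (k + 2) \<le> x' / ?S" using x1 by linarith
  have "real_of_int (y' * scale) \<le> of_int (y * (scale - P))" using h by (simp only: of_int_le_iff)
  then have "y' * ?S \<le> y * (1 - p) * ?S" by (simp add: P algebra_simps)
  then have "y' \<le> y * (1 - p)" using scale_pos by (rule mult_right_le_imp_le)
  then have y1: "y' / ?S \<le> y / ?S * (1 - p)" using scale_pos by (simp add: divide_right_mono)
  also have "\<dots> \<le> (1 - p) ^ (k + 1) * (1 - p)" using Cons.prems(4) p by (intro mult_right_mono) auto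
  finally have y': "y' / ?S \<le> (1 - p) ^ (k + 2)" by (simp add: mult_ac)
  have "real_of_int (cert_step P i x x' y' z) \<le> real_of_int (z' * scale * scale)" using h by (simp only: of_int_le_iff)
  then have "?S^2 * (z - z * (x' / scale + i * (x / scale) * (1 - p)) + x' * (1 - p) - y') \<le> ?S^2 * z'"
    unfolding cert_step_real by (simp add: power2_eq_square mult_ac)
  then have z1: "z - z * (x' / scale + i * (x / scale) * (1 - p)) + x' * (1 - p) - y' \<le> z'"
    using scale_pos by (simp only: mult_le_cancel_left_pos zero_less_power)
  have "?S * B_seq p (Suc k) \<le> z - z * (x' / ?S + real (k + 2) * (x / ?S) * (1 - p)) + ?S * (x' / ?S) * (1 - p) - ?S * (y' / ?S)"
    by (rule B_seq_step_upper) (use h(1) Cons.prems x' y' scale_pos in \<open>auto simp: field_simps\<close>)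
  also have "\<dots> = z - z * (x' / scale + i * (x / scale) * (1 - p)) + x' * (1 - p) - y'"
    using scale_pos Cons.prems(2) by simp
  also note z1
  finally have z': "B_seq p (Suc k) \<le> z' / ?S" using scale_pos by (simp add: field_simps)
  have "B_seq p k \<le> 0"
    using Cons.prems(5) h(1) scale_pos by (meson divide_nonpos_pos of_int_le_0_iff order_trans)
  moreover have "(\<forall>m. Suc k \<le> m \<and> m < Suc k + length cs \<longrightarrow> B_seq p m \<le> 0) \<and>
    B_seq p (Suc k + length cs) \<le> - 2 * p ^ (Suc k + length cs + 1)"
    by (rule Cons.IH[OF h(5) _ _ _ z']) (use x' y' Cons.prems(2) in auto)
  ultimately show ?case by (auto simp: le_eq_less_or_eq[of k] Suc_le_eq)
qed

end

text \<open>
  The bound \<open>- 2 * p ^ (k + 1)\<close> outweighs the sum of all later gains, so a finite computation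
  settles the sign of the whole sequence.
\<close>

lemma B_seq_stays_negative:
  assumes p: "p \<in> {0..1}" and f: "near_all p n \<le> (1 - p) / 2" and b: "B_seq p n \<le> - 2 * p ^ (n + 1)"
    and "n \<le> k"
  shows "B_seq p k \<le> - 2 * p ^ (k + 1)"
  using \<open>n \<le> k\<close>
proof (induction k rule: dec_induct)
  case (step k)
  have fk: "near_all p k \<le> (1 - p) / 2" using near_all_antimono[OF p step(1)] f by linarith
  have "B_seq p k * (1 - near_all p k) \<le> - 2 * p ^ (k + 1) * (1 - near_all p k)"
    using step near_all_le_1[OF p, of k] by (intro mult_right_mono) auto
  also have "\<dots> \<le> - 2 * p ^ (k + 1) * (1 - (1 - p) / 2)"
    using fk p by (intro mult_left_mono_neg) auto
  finally have "B_seq p (Suc k) \<le> - 2 * p ^ (k + 1) * (1 - (1 - p) / 2) + p ^ (k + 2) * (1 - p)"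
    unfolding B_seq.simps gain_def using zero_le_power[of "1 - p" "k + 2"] p
    by (smt (verit) atLeastAtMost_iff)
  \<comment> \<open>With damping at most \<open>(1 - p) / 2\<close>, what remains after reproducing
    the bound is minus a multiple of a square.\<close>
  also have "\<dots> = - 2 * p ^ (Suc k + 1) + - (p ^ (k + 1) * (1 - p) ^ 2)" 
    by (simp add: field_simps power2_eq_square)
  also have "\<dots> \<le> - 2 * p ^ (Suc k + 1)" using p by simp
  finally show ?case .
qed (rule b)

definition lower_list :: "(int \<times> int \<times> int) list" where
  "lower_list = [
    (301952643367631427, 202948287839171428, -66919279583719351),
    (165923635112179349, 91427761698024933, -45186425173817988),
    (91175398836700011, 41188007536851178, -27669801414683240),
    (50101080219288898, 18555107697581937, -16585603444551116),
    (27530652688839635, 8359035609110836, -9839462520979528),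
    (15128153607788033, 3765727337895685, -5786899229561614),
    (8312953353031317, 1696451964855710, -3374766572346657),
    (4567985971143166, 764247915695091, -1951985353065519),
    (2510118239139620, 344292021668865, -1120405583696266),
    (1379315438852935, 155102805974975, -638647860085943),
    (757936837473512, 69873476314384, -361826281618021),
    (416487942799428, 31477848911673, -203920435636422),
    (228861031580829, 14180702383376, -114417418796124),
    (125759635259033, 6388375541485, -63960014500774),
    (69105193449673, 2877949269064, -35643826743690),
    (37973454295413, 1296509878219, -19813160516448),
    (20866495832559, 584074876645, -10990410059151), (11466184902299, 263124459952, -6085954221027),
    (6300693574460, 118536996186, -3365375398737), (3462244840590, 53400658637, -1858830043532),
    (1902511079857, 24056880422, -1025742505095), (1045433981601, 10837572240, -565593052757),
    (574468249598, 4882302693, -311671942149), (315671554210, 2199466731, -171659946289),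
    (173462206496, 990854973, -94505790516), (95317860229, 446378008, -52011471666),
    (52377371775, 201092321, -28616606809), (28781479855, 90591653, -15741184062),
    (15815485859, 40811343, -8657147096), (8690643921, 18385422, -4760414371),
    (4775527760, 8282593, -2617331489), (2624162904, 3731291, -1438882914),
    (1441983230, 1680939, -790953489), (792372925, 757260, -434748454),
    (435410647, 341144, -238938044), (239259098, 153685, -131306025), (131473395, 69235, -72146782),
    (72244916, 31191, -39631796), (39698738, 14052, -21761653), (21814542, 6331, -11940581),
    (11987138, 2853, -6543255), (6586958, 1286, -3577131), (3619547, 580, -1947113),
    (1988948, 262, -1051359), (1092931, 119, -559115), (600567, 54, -288615), (330012, 25, -139971),
    (181342, 12, -58289), (99647, 6, -13405), (54756, 3, 11259)]"

text \<open>The starting triple is exact: it holds p, \<open>1 - p\<close> and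
  \<open>B_seq p 0 = 0\<close>, scaled. The length is the index at which positivity is
  certified.\<close>

lemma lower_list:
  "lower_cert 549502177764230000 2 549502177764230000 450497822235770000 0 lower_list"
  "length lower_list = 50"
  by (simp_all add: lower_list_def cert_step_def scale_def)

definition upper_list :: "(int \<times> int \<times> int) list" where
  "upper_list = [
    (301952643367565487, 202948287839225486, -66919279583784996),
    (165923635112124998, 91427761698061462, -45186425173902973),
    (91175398836660190, 41188007536873119, -27669801414773900),
    (50101080219261547, 18555107697594292, -16585603444642766),
    (27530652688821600, 8359035609117514, -9839462521070620),
    (15128153607776472, 3765727337899194, -5786899229651788),
    (8312953353024057, 1696451964857516, -3374766572435983),
    (4567985971138679, 764247915696005, -1951985353154185),
    (2510118239136882, 344292021669322, -1120405583784463),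
    (1379315438851281, 155102805975200, -638647860173823),
    (757936837472521, 69873476314494, -361826281705695),
    (416487942798839, 31477848911726, -203920435723965),
    (228861031580482, 14180702383401, -114417418883584),
    (125759635258830, 6388375541496, -63960014588182),
    (69105193449555, 2877949269068, -35643826831064),
    (37973454295345, 1296509878220, -19813160603801),
    (20866495832521, 584074876645, -10990410146490), (11466184902278, 263124459951, -6085954308356),
    (6300693574449, 118536996184, -3365375486058), (3462244840585, 53400658635, -1858830130846),
    (1902511079855, 24056880421, -1025742592405), (1045433981601, 10837572239, -565593140064),
    (574468249599, 4882302691, -311672029452), (315671554212, 2199466729, -171660033588),
    (173462206498, 990854971, -94505877811), (95317860231, 446378006, -52011558956),
    (52377371777, 201092319, -28616694095), (28781479858, 90591651, -15741271343),
    (15815485862, 40811341, -8657234373), (8690643924, 18385420, -4760501644),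
    (4775527763, 8282591, -2617418758), (2624162906, 3731289, -1438970179),
    (1441983232, 1680937, -791040750), (792372927, 757258, -434835711),
    (435410649, 341143, -239025299), (239259100, 153684, -131393277), (131473397, 69234, -72234031),
    (72244918, 31189, -39719041), (39698740, 14050, -21848895), (21814545, 6329, -12027818),
    (11987140, 2851, -6630488), (6586960, 1284, -3664360), (3619549, 578, -2034339),
    (1988951, 260, -1138580), (1092933, 117, -646333), (600570, 52, -375829), (330015, 23, -227180),
    (181344, 10, -145494), (99649, 4, -100606), (54758, 1, -75938), (30090, 0, -62382)]"

lemma upper_list:
  "upper_cert 549502177764170000 2 549502177764170000 450497822235830000 0 upper_list"
  "length upper_list = 51"
  by (simp_all add: upper_list_def cert_step_def scale_def)

lemma B_seq_neg_below: "B_seq (54950217776417 / 10 ^ 14) k \<le> 0"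
proof -
  define p :: real where "p = 54950217776417 / 10 ^ 14"
  have p: "p \<in> {0..1}" and P: "real_of_int 549502177764170000 = real_of_int scale * p"
    by (simp_all add: p_def scale_def)
  have "(\<forall>m. 0 \<le> m \<and> m < 0 + 51 \<longrightarrow> B_seq p m \<le> 0) \<and> B_seq p (0 + 51) \<le> - 2 * p ^ (0 + 51 + 1)"
    using upper_cert_sound[OF P p upper_list(1), of 0] by (simp add: p_def scale_def upper_list(2))
  then have neg: "\<And>m. m < 51 \<Longrightarrow> B_seq p m \<le> 0" and b: "B_seq p 51 \<le> - 2 * p ^ (51 + 1)"
    by simp_all
  have "near_all p 51 \<le> real (51 + 2) * (5/8) ^ (51 + 1)"
    by (rule near_all_le) (simp add: p_def)
  also have "\<dots> \<le> (1 - p) / 2" by (simp add: p_def power_divide)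
  finally have f: "near_all p 51 \<le> (1 - p) / 2" .
  have "B_seq p k \<le> 0"
  proof (cases "k < 51")
    case False
    then have "B_seq p k \<le> - 2 * p ^ (k + 1)" by (intro B_seq_stays_negative[OF p f b]) auto
    also have "\<dots> \<le> 0" using p by simp
    finally show ?thesis .
  qed (rule neg)
  then show ?thesis by (simp add: p_def)
qed

lemma B_seq_pos_above: "0 < B_seq (54950217776423 / 10 ^ 14) 50"
proof -
  define p :: real where "p = 54950217776423 / 10 ^ 14"
  have p: "p \<in> {0..1}" and P: "real_of_int 549502177764230000 = real_of_int scale * p"
    by (simp_all add: p_def scale_def)
  show ?thesis
    using lower_cert_sound[OF P p lower_list(1), of 0] by (simp add: p_def scale_def lower_list(2))
qed

section \<open>Optimal moves\<close>

lemma s_seq_1: "p \<in> {0..1} \<Longrightarrow> s_seq (Suc 0) p = 0"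
  using v_recurrence[of p 1] by (simp add: s_seq_def)

lemma s_seq_le: "p \<in> {0..1} \<Longrightarrow> s_seq n p \<le> 1 - p"
  using v_le[of p n] by (simp add: s_seq_def)

lemma sum_inner_binomial_weights:
  "(\<Sum>j = 1..Suc k. real (Suc (Suc k) choose j) * p ^ j * (1 - p) ^ (Suc (Suc k) - j)) =
     1 - p ^ (k + 2) - (1 - p) ^ (k + 2)"
proof -
  have "{..Suc (Suc k)} = insert 0 (insert (Suc (Suc k)) {1..Suc k})" by auto
  then show ?thesis using sum_binomial_weights[of "Suc (Suc k)" p]
    by (simp del: sum.atMost_Suc sum.cl_ivl_Suc binomial_Suc_Suc power_Suc) 
qed

text \<open>The value \<open>v (k + 2 - i) p + i\<close> exceeds \<open>s_seq (k + 2 - i) p\<close>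
  by \<open>k + 1 + p\<close>, which does not depend on i, so the maximum acts on
  \<open>s_seq\<close> alone. The outcomes with all heads and with no head leave
  \<open>gain\<close>.\<close>

lemma s_seq_recurrence:
  assumes p: "p \<in> {0..1}"
  shows "s_seq (k + 2) p = gain p k + (1 - p) ^ (k + 2) * s_seq (k + 1) p +
    (\<Sum>j = 1..k + 1. real (k + 2 choose j) * p ^ j * (1 - p) ^ (k + 2 - j) *
       Max ((\<lambda>i. s_seq (k + 2 - i) p) ` {1..j}))"
proof -
  let ?w = "\<lambda>j. real (k + 2 choose j) * p ^ j * (1 - p) ^ (k + 2 - j)"
  let ?M = "\<lambda>j. Max ((\<lambda>i. s_seq (k + 2 - i) p) ` {1..j})"
  have M: "Max ((\<lambda>i. v (k + 2 - i) p + real i) ` {1..j}) = ?M j + (real k + 1 + p)"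
    if "j \<in> {1..k + 1}" for j
  proof -
    have "v (k + 2 - i) p + real i = s_seq (k + 2 - i) p + (real k + 1 + p)" if "i \<in> {1..j}" for i
      using that \<open>j \<in> {1..k + 1}\<close> by (simp add: s_seq_def of_nat_diff)
    then have "(\<lambda>i. v (k + 2 - i) p + real i) ` {1..j} =
        (\<lambda>i. s_seq (k + 2 - i) p + (real k + 1 + p)) ` {1..j}"
      by (intro image_cong) auto
    then show ?thesis using that by (simp add: Max_add_commute)
  qed
  have "v (k + 2) p = real (k + 2) * p ^ (k + 2) + v (k + 1) p * (1 - p) ^ (k + 2) +
      (\<Sum>j = 1..k + 1. ?w j * Max ((\<lambda>i. v (k + 2 - i) p + real i) ` {1..j}))"
    using v_recurrence[OF p, of "k + 2"] by (simp add: algebra_simps del: binomial_Suc_Suc sum.cl_ivl_Suc power_Suc)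
  also have "(\<Sum>j = 1..k + 1. ?w j * Max ((\<lambda>i. v (k + 2 - i) p + real i) ` {1..j})) =
      (\<Sum>j = 1..k + 1. ?w j * ?M j + ?w j * (real k + 1 + p))"
    using M by (intro sum.cong refl) (simp add: distrib_left)
  also have "\<dots> = (\<Sum>j = 1..k + 1. ?w j * ?M j) + (\<Sum>j = 1..k + 1. ?w j) * (real k + 1 + p)"
    by (simp only: sum.distrib sum_distrib_right)
  also have "(\<Sum>j = 1..k + 1. ?w j) = 1 - p ^ (k + 2) - (1 - p) ^ (k + 2)"
    using sum_inner_binomial_weights[of k p] by (simp only: add_2_eq_Suc' Suc_eq_plus1)
  finally have v2: "v (k + 2) p = real (k + 2) * p ^ (k + 2) + v (k + 1) p * (1 - p) ^ (k + 2) +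
    ((\<Sum>j = 1..k + 1. ?w j * ?M j) + (1 - p ^ (k + 2) - (1 - p) ^ (k + 2)) * (real k + 1 + p))" .
  have v1: "v (k + 1) p = s_seq (k + 1) p + real k + p" by (simp add: s_seq_def)
  have "s_seq (k + 2) p = v (k + 2) p - (real k + 1 + p)" by (simp add: s_seq_def)
  then show ?thesis unfolding v2 v1 gain_def of_nat_add of_nat_numeral
    by (simp only: ring_distribs mult_1 mult_1_right) (simp add: mult_ac del: power_Suc)
qed

lemma s_seq_step_A:
  assumes p: "p \<in> {0..1}" and "\<And>m. m \<le> k \<Longrightarrow> s_seq (Suc m) p \<le> s_seq (Suc k) p"
  shows "s_seq (Suc (Suc k)) p = s_seq (Suc k) p * (1 - p ^ (k + 2)) + gain p k"
proof -
  let ?w = "\<lambda>j. real (k + 2 choose j) * p ^ j * (1 - p) ^ (k + 2 - j)"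
  have M: "Max ((\<lambda>i. s_seq (k + 2 - i) p) ` {1..j}) = s_seq (k + 1) p" if "j \<in> {1..k + 1}" for j
  proof (rule Max_eqI)
    fix y assume "y \<in> (\<lambda>i. s_seq (k + 2 - i) p) ` {1..j}"
    then obtain i where i: "y = s_seq (k + 2 - i) p" "1 \<le> i" "i \<le> j" by auto
    then have "y = s_seq (Suc (k + 1 - i)) p" using that by (simp add: Suc_diff_le)
    then show "y \<le> s_seq (k + 1) p" using assms(2)[of "k + 1 - i"] i by simp
  qed (use that in \<open>auto intro!: image_eqI[where x = 1]\<close>)
  have "(\<Sum>j = 1..k + 1. ?w j * Max ((\<lambda>i. s_seq (k + 2 - i) p) ` {1..j})) =
      (\<Sum>j = 1..k + 1. ?w j * s_seq (k + 1) p)"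
    using M by (intro sum.cong refl arg_cong[where f = "(*) x" for x]) auto
  also have "\<dots> = (1 - p ^ (k + 2) - (1 - p) ^ (k + 2)) * s_seq (k + 1) p"
    unfolding sum_distrib_right[symmetric]
    using sum_inner_binomial_weights[of k p] by (simp only: add_2_eq_Suc' Suc_eq_plus1)
  finally show ?thesis using s_seq_recurrence[OF p, of k]
    by (simp add: algebra_simps del: power_Suc sum.cl_ivl_Suc)
qed

text \<open>With at most k heads among \<open>k + 2\<close> coins at least two coins remain, so
  \<open>s_seq 1 p = 0\<close> is out of reach and one head is best. With \<open>k + 1\<close> heads
  it is reachable and is the maximum, as all values are nonpositive.\<close>

lemma s_seq_step_B:
  assumes p: "p \<in> {0..1}"
    and le: "\<And>m. 1 \<le> m \<Longrightarrow> m \<le> k \<Longrightarrow> s_seq (Suc m) p \<le> s_seq (Suc k) p"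
    and neg: "\<And>m. m \<le> k \<Longrightarrow> s_seq (Suc m) p \<le> 0"
  shows "s_seq (Suc (Suc k)) p = s_seq (Suc k) p * (1 - near_all p k) + gain p k"
proof -
  let ?w = "\<lambda>j. real (k + 2 choose j) * p ^ j * (1 - p) ^ (k + 2 - j)"
  let ?M = "\<lambda>j. Max ((\<lambda>i. s_seq (k + 2 - i) p) ` {1..j})"
  have M: "?M j = s_seq (k + 1) p" if "j \<in> {1..k}" for j
  proof (rule Max_eqI)
    fix y assume "y \<in> (\<lambda>i. s_seq (k + 2 - i) p) ` {1..j}"
    then obtain i where i: "y = s_seq (k + 2 - i) p" "1 \<le> i" "i \<le> j" by auto
    then have "y = s_seq (Suc (k + 1 - i)) p" using that by (simp add: Suc_diff_le)
    then show "y \<le> s_seq (k + 1) p" using le[of "k + 1 - i"] i that by simp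
  qed (use that in \<open>auto intro!: image_eqI[where x = 1]\<close>)
  have M1: "?M (k + 1) = 0"
  proof (rule Max_eqI)
    fix y assume "y \<in> (\<lambda>i. s_seq (k + 2 - i) p) ` {1..k + 1}"
    then obtain i where i: "y = s_seq (k + 2 - i) p" "1 \<le> i" "i \<le> k + 1" by auto
    then have "y = s_seq (Suc (k + 1 - i)) p" by (simp add: Suc_diff_le)
    then show "y \<le> 0" using neg[of "k + 1 - i"] i by simp
  next
    show "0 \<in> (\<lambda>i. s_seq (k + 2 - i) p) ` {1..k + 1}"
      by (rule image_eqI[where x = "k + 1"]) (use s_seq_1[OF p] in auto)
  qed simp
  have wk: "?w (k + 1) = real (k + 2) * p ^ (k + 1) * (1 - p)"
    using binomial_symmetric[of "k + 1" "k + 2"] by simp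
  have last: "(\<Sum>j = 1..k + 1. h j) = h (k + 1) + (\<Sum>j = 1..k. h j)" for h :: "nat \<Rightarrow> real"
    by simp
  have W: "(\<Sum>j = 1..k. ?w j) = 1 - p ^ (k + 2) - (1 - p) ^ (k + 2) - ?w (k + 1)"
    using sum_inner_binomial_weights[of k p] unfolding Suc_eq_plus1[symmetric] add_2_eq_Suc'
    by (simp only: sum.cl_ivl_Suc) simp
  have "(\<Sum>j = 1..k + 1. ?w j * ?M j) = ?w (k + 1) * ?M (k + 1) + (\<Sum>j = 1..k. ?w j * ?M j)"
    by (rule last)
  also have "(\<Sum>j = 1..k. ?w j * ?M j) = (\<Sum>j = 1..k. ?w j * s_seq (k + 1) p)"
    using M by (intro sum.cong refl arg_cong[where f = "(*) x" for x]) auto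
  also have "\<dots> = (1 - near_all p k - (1 - p) ^ (k + 2)) * s_seq (k + 1) p"
    unfolding sum_distrib_right[symmetric] W wk near_all_def by (simp only: algebra_simps)
  finally have "(\<Sum>j = 1..k + 1. ?w j * ?M j) = (1 - near_all p k - (1 - p) ^ (k + 2)) * s_seq (k + 1) p"
    unfolding M1 by simp
  then show ?thesis using s_seq_recurrence[OF p, of k]
    by (simp add: algebra_simps del: power_Suc sum.cl_ivl_Suc)
qed

section \<open>From inequalities between values of s_seq to optimal moves\<close>

lemma optimal_no_heads:
  assumes p: "p \<in> {0..1}" and "1 \<le> n" shows "optimal_move p n 0 (0, 1)"
  using assms by (auto simp: optimal_move_def moves_def intro!: v_mono[OF p])

text \<open>Since v is monotone in the number of coins, a move that sets aside tails is no better
  than one that sets aside heads only. Among the latter the comparison is one between values of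
  \<open>s_seq\<close>.\<close>

lemma optimal_heads:
  assumes p: "p \<in> {0..1}" and j: "1 \<le> a" "a \<le> j" "j \<le> n"
    and le: "\<And>i. 1 \<le> i \<Longrightarrow> i \<le> j \<Longrightarrow> s_seq (n - i) p \<le> s_seq (n - a) p"
  shows "optimal_move p n j (a, 0)"
proof -
  have *: "real i + v (n - i) p \<le> real a + v (n - a) p" if "1 \<le> i" "i \<le> j" for i
    using le[OF that] that j by (simp add: s_seq_def of_nat_diff)
  have "real a' + v (n - a' - b') p \<le> real a + v (n - a) p" if m: "(a', b') \<in> moves n j" for a' b'
  proof (cases "a' = 0")
    case True
    then have "v (n - a' - b') p \<le> v (n - 1) p"
      using m by (intro v_mono[OF p]) (auto simp: moves_def)
    then show ?thesis using *[of 1] True j by simp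
  next
    case False
    have "v (n - a' - b') p \<le> v (n - a') p" by (intro v_mono[OF p]) auto
    then show ?thesis using *[of a'] False m by (auto simp: moves_def)
  qed
  then show ?thesis using j by (auto simp: optimal_move_def moves_def)
qed

text \<open>No coin remains, and \<open>s_seq 0 p = 1 - p\<close> attains the bound of
  \<open>s_seq_le\<close>.\<close>

lemma optimal_all_heads: "p \<in> {0..1} \<Longrightarrow> 1 \<le> n \<Longrightarrow> optimal_move p n n (n, 0)"
  by (rule optimal_heads) (auto simp: s_seq_le s_seq_def[of 0])

lemma optimal_strategy_A:
  assumes p: "p \<in> {0..1}" and "1 \<le> k" and le: "\<And>m. m \<le> k \<Longrightarrow> s_seq (Suc m) p \<le> s_seq (Suc k) p"
  shows "optimal_at p (Suc (Suc k)) strategy_A"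
  unfolding optimal_at_def
proof (intro allI impI)
  fix j assume j: "j \<le> Suc (Suc k)"
  consider "j = Suc (Suc k)" | "j = 0" | "1 \<le> j" "j \<le> Suc k" using j by linarith
  then show "optimal_move p (Suc (Suc k)) j (strategy_A (Suc (Suc k)) j)"
  proof cases
    case 3
    have "optimal_move p (Suc (Suc k)) j (1, 0)"
    proof (rule optimal_heads[OF p])
      fix i assume "1 \<le> i" "i \<le> j"
      then show "s_seq (Suc (Suc k) - i) p \<le> s_seq (Suc (Suc k) - 1) p"
        using le[of "Suc k - i"] 3 by (simp add: Suc_diff_le)
    qed (use 3 in auto)
    then show ?thesis using 3 by (simp add: strategy_A_def)
  qed (simp_all add: strategy_A_def optimal_all_heads[OF p] optimal_no_heads[OF p, simplified])
qed

lemma optimal_strategy_B: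
  assumes p: "p \<in> {0..1}" and k: "1 \<le> k"
    and le: "\<And>m. 1 \<le> m \<Longrightarrow> m \<le> k \<Longrightarrow> s_seq (Suc m) p \<le> s_seq (Suc k) p"
    and neg: "\<And>m. m \<le> k \<Longrightarrow> s_seq (Suc m) p \<le> 0"
  shows "optimal_at p (Suc (Suc k)) strategy_B"
  unfolding optimal_at_def
proof (intro allI impI)
  fix j assume j: "j \<le> Suc (Suc k)"
  consider "j = Suc (Suc k)" | "j = 0" | "1 \<le> j" "j \<le> k" | "j = Suc k" using j by linarith
  then show "optimal_move p (Suc (Suc k)) j (strategy_B (Suc (Suc k)) j)"
  proof cases
    case 3
    have "optimal_move p (Suc (Suc k)) j (1, 0)"
    proof (rule optimal_heads[OF p])
      fix i assume "1 \<le> i" "i \<le> j"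
      then show "s_seq (Suc (Suc k) - i) p \<le> s_seq (Suc (Suc k) - 1) p"
        using le[of "Suc k - i"] 3 by (simp add: Suc_diff_le)
    qed (use 3 in auto)
    then show ?thesis using 3 by (simp add: strategy_B_def)
  next
    case 4
    have "optimal_move p (Suc (Suc k)) (Suc k) (Suc k, 0)"
    proof (rule optimal_heads[OF p])
      fix i assume "1 \<le> i" "i \<le> Suc k"
      then show "s_seq (Suc (Suc k) - i) p \<le> s_seq (Suc (Suc k) - Suc k) p"
        using neg[of "Suc k - i"] by (simp add: Suc_diff_le s_seq_1[OF p])
    qed auto
    then show ?thesis using 4 by (simp add: strategy_B_def)
  qed (use k in \<open>simp_all add: strategy_B_def optimal_all_heads[OF p] optimal_no_heads[OF p, simplified]\<close>)
qed

text \<open>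
  Once \<open>s_seq\<close> is at its running maximum, strategy A stays optimal provided the gap \<open>1 - p - s_seq\<close>
  is at least \<open>((1 - p) / p) ^ (k + 2)\<close>, and this condition reproduces itself.
\<close>

lemma A_regime:
  assumes p: "p \<in> {1/2..<1}"
    and max: "\<And>m. m \<le> K \<Longrightarrow> s_seq (Suc m) p \<le> s_seq (Suc K) p"
    and gap: "((1 - p) / p) ^ (K + 2) \<le> 1 - p - s_seq (Suc K) p"
    and "K \<le> k"
  shows "(\<forall>m\<le>k. s_seq (Suc m) p \<le> s_seq (Suc k) p) \<and> ((1 - p) / p) ^ (k + 2) \<le> 1 - p - s_seq (Suc k) p"
  using \<open>K \<le> k\<close>
proof (induction k rule: dec_induct)
  case base then show ?case using max gap by auto
next
  case (step k)
  let ?r = "(1 - p) / p" and ?x = "s_seq (Suc k) p" and ?x' = "s_seq (Suc (Suc k)) p"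
  have pk: "p ^ (k + 2) * ?r ^ (k + 2) = (1 - p) ^ (k + 2)" using p by (simp add: power_divide)
  have x': "?x' = ?x * (1 - p ^ (k + 2)) + gain p k"
    by (rule s_seq_step_A) (use p step in auto)
  \<comment> \<open>The increment \<open>?x' - ?x\<close> equals
    \<open>p ^ (k + 2) * (1 - p - ?x) - (1 - p) ^ (k + 2)\<close>, so the gap condition says exactly
    that it is nonnegative.\<close>
  have "p ^ (k + 2) * ?r ^ (k + 2) \<le> p ^ (k + 2) * (1 - p - ?x)"
    using step p by (intro mult_left_mono) auto
  then have up: "?x \<le> ?x'" unfolding pk x' gain_def by (simp add: algebra_simps)
  \<comment> \<open>The affine map that sends the gap at k to the next gap has
    \<open>?r ^ (k + 2)\<close> as a fixed point and is increasing, so the next gap is again at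
    least this number.\<close>
  have "?r ^ (k + 2) = ?r ^ (k + 2) * (1 - p ^ (k + 2)) + (1 - p) ^ (k + 2)"
    unfolding pk[symmetric] by (simp only: algebra_simps)
  also have "\<dots> \<le> (1 - p - ?x) * (1 - p ^ (k + 2)) + (1 - p) ^ (k + 2)"
    using step p by (intro add_right_mono mult_right_mono) (auto intro: power_le_one simp del: power_Suc)
  also have "\<dots> = 1 - p - ?x'" unfolding x' gain_def by (simp only: algebra_simps)
  finally have "?r ^ (k + 2) \<le> 1 - p - ?x'" .
  moreover have "?r ^ (Suc k + 2) \<le> ?r ^ (k + 2)"
    using p by (intro power_decreasing) (auto simp: field_simps)
  ultimately show ?case using step up by (auto simp: le_Suc_eq intro: order_trans)
qed

text \<open>The recurrence looks only at smaller sizes, so the equality extends to the first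
  positive value, where \<open>A_regime\<close> takes over.\<close>

lemma s_seq_eq_B_seq:
  assumes p: "p \<in> {1/2..<1}"
  shows "(\<And>m. m < k \<Longrightarrow> B_seq p m \<le> 0) \<Longrightarrow> s_seq (Suc k) p = B_seq p k"
proof (induction k rule: less_induct)
  case (less k)
  show ?case
  proof (cases k)
    case 0 then show ?thesis using s_seq_1[of p] p by simp
  next
    case (Suc l)
    have x: "s_seq (Suc m) p = B_seq p m" if "m \<le> l" for m
      using less that Suc by auto
    have "s_seq (Suc (Suc l)) p = s_seq (Suc l) p * (1 - near_all p l) + gain p l"
    proof (rule s_seq_step_B)
      show "s_seq (Suc m) p \<le> s_seq (Suc l) p" if "1 \<le> m" "m \<le> l" for m
        using B_seq_mono_nonpos[of p m l] p that x less.prems Suc by auto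
    qed (use p x less.prems Suc in auto)
    then show ?thesis using x[of l] Suc by (simp add: B_seq.simps)
  qed
qed

lemma optimal_B_of_B_seq:
  assumes p: "p \<in> {1/2..<1}" and "1 \<le> k" "\<And>m. m \<le> k \<Longrightarrow> B_seq p m \<le> 0"
  shows "optimal_at p (Suc (Suc k)) strategy_B"
proof (rule optimal_strategy_B)
  have x: "s_seq (Suc m) p = B_seq p m" if "m \<le> k" for m
    by (rule s_seq_eq_B_seq[OF p]) (use assms that in auto)
  show "s_seq (Suc m) p \<le> 0" if "m \<le> k" for m using x that assms by simp
  show "s_seq (Suc m) p \<le> s_seq (Suc k) p" if "1 \<le> m" "m \<le> k" for m
    using x that B_seq_mono_nonpos[of p m k] assms by auto
qed (use assms in auto)

lemma convergent_s_seq: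
  assumes p: "p \<in> {0..1}" and "\<And>k. K \<le> k \<Longrightarrow> s_seq (Suc k) p \<le> s_seq (Suc (Suc k)) p"
  shows "convergent (\<lambda>n. s_seq n p)" "K \<le> k \<Longrightarrow> s_seq (Suc k) p \<le> s p"
    "(\<lambda>n. s_seq n p) \<longlonglongrightarrow> s p"
proof -
  let ?y = "\<lambda>i. s_seq (i + Suc K) p"
  have inc: "incseq ?y" by (rule incseq_SucI) (use assms(2)[of "i + K" for i] in auto)
  have "convergent ?y"
    by (rule incseq_convergent[OF inc, of "1 - p"]) (auto simp: s_seq_le[OF p] convergent_def)
  then show c: "convergent (\<lambda>n. s_seq n p)" by (simp only: convergent_ignore_initial_segment[of "\<lambda>n. s_seq n p"])
  then show l: "(\<lambda>n. s_seq n p) \<longlonglongrightarrow> s p" unfolding s_def by (simp add: convergent_LIMSEQ_iff)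
  assume "K \<le> k"
  then show "s_seq (Suc k) p \<le> s p"
    using incseq_le[OF inc LIMSEQ_ignore_initial_segment[OF l], of "k - K"] by simp
qed

section \<open>The three parameter regimes\<close>

lemma phi_bounds: "\<phi> ^ 2 + \<phi> = 1" "61/100 < \<phi>" "\<phi> < 5/8"
proof -
  show "\<phi> ^ 2 + \<phi> = 1" by (simp add: \<phi>_def power2_eq_square field_simps)
  have "sqrt 5 < 9/4" by (rule real_less_lsqrt) (auto simp: power2_eq_square)
  moreover have "222/100 < sqrt 5" by (rule real_less_rsqrt) (auto simp: power2_eq_square)
  ultimately show "61/100 < \<phi>" "\<phi> < 5/8" by (auto simp: \<phi>_def)
qed

lemma quadratic_sign:
  assumes "0 \<le> p" shows "0 \<le> p ^ 2 + p - 1 \<longleftrightarrow> \<phi> \<le> p" "0 < p ^ 2 + p - 1 \<longleftrightarrow> \<phi> < p"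
proof -
  have "p ^ 2 + p - 1 = p ^ 2 + p - (\<phi> ^ 2 + \<phi>)" using phi_bounds(1) by simp
  also have "\<dots> = (p - \<phi>) * (p + \<phi> + 1)" by (simp add: power2_eq_square algebra_simps)
  finally have e: "p ^ 2 + p - 1 = (p - \<phi>) * (p + \<phi> + 1)" .
  have "0 < p + \<phi> + 1" using phi_bounds assms by simp
  then show "0 \<le> p ^ 2 + p - 1 \<longleftrightarrow> \<phi> \<le> p" "0 < p ^ 2 + p - 1 \<longleftrightarrow> \<phi> < p"
    unfolding e by (auto simp: zero_le_mult_iff zero_less_mult_iff)
qed

text \<open>Here \<open>s_seq 2 p\<close> is already at least \<open>s_seq 1 p = 0\<close>, so
  \<open>A_regime\<close> can start at \<open>K = 1\<close>.\<close>

lemma large_p: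
  assumes p: "p \<in> {\<phi>..<1}"
  shows "\<forall>n\<ge>3. optimal_at p n strategy_A" "convergent (\<lambda>n. s_seq n p)" "0 < s p"
proof -
  have p2: "p \<in> {1/2..<1}" "p \<in> {0..1}" "61/100 \<le> p" using p phi_bounds by auto
  have q: "0 \<le> p ^ 2 + p - 1" using quadratic_sign(1)[of p] p p2 by simp
  have x1: "s_seq (Suc 1) p = (1 - p) * (p ^ 2 + p - 1)"
    using s_seq_eq_B_seq[OF p2(1), of 1] B_seq_1[of p] by simp
  \<comment> \<open>This inequality serves twice: for the gap condition at \<open>K = 1\<close> and
    for the strict growth from \<open>s_seq 2 p\<close> to \<open>s_seq 3 p\<close>. The number
    61/100 is a rational lower bound of \<phi>.\<close>
  have c: "1 - p < p ^ 3 * (2 + p)"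
  proof -
    have "(61/100) ^ 3 * (2 + 61/100) \<le> p ^ 3 * (2 + p)"
      using p2 by (intro mult_mono power_mono) auto
    then show ?thesis using p2 by (simp add: power_divide)
  qed
  have e: "1 - p - s_seq (Suc 1) p = (1 - p) ^ 2 * (2 + p)"
    unfolding x1 by (simp add: power2_eq_square algebra_simps)
  have "((1 - p) / p) ^ (1 + 2) = (1 - p) ^ 2 * ((1 - p) / p ^ 3)"
    by (simp add: power_divide eval_nat_numeral)
  also have "\<dots> \<le> (1 - p) ^ 2 * (2 + p)"
    using c p2 by (intro mult_left_mono) (auto simp: divide_le_eq mult_ac)
  finally have gap: "((1 - p) / p) ^ (1 + 2) \<le> 1 - p - s_seq (Suc 1) p" using e by simp
  have max: "s_seq (Suc m) p \<le> s_seq (Suc 1) p" if "m \<le> 1" for m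
    using that q p2 s_seq_1[of p] unfolding x1 by (cases m) (auto simp: x1[simplified])
  note A = A_regime[OF p2(1) max gap]
  show "\<forall>n\<ge>3. optimal_at p n strategy_A"
  proof (intro allI impI)
    fix n :: nat assume "3 \<le> n"
    then obtain k where k: "n = Suc (Suc k)" "1 \<le> k" by (cases n; cases "n - 1") auto
    show "optimal_at p n strategy_A" unfolding k(1)
      by (rule optimal_strategy_A[OF p2(2) k(2)]) (use A[of k] k in auto)
  qed
  have inc: "s_seq (Suc k) p \<le> s_seq (Suc (Suc k)) p" if "1 \<le> k" for k
    using A[of "Suc k"] that by auto
  show "convergent (\<lambda>n. s_seq n p)" by (rule convergent_s_seq(1)[OF p2(2) inc])
  \<comment> \<open>At \<open>p = \<phi>\<close> the value \<open>s_seq 2 p\<close> is 0, so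
    positivity of the limit is read off one step later.\<close>
  have "s_seq (Suc (Suc 1)) p = s_seq (Suc 1) p * (1 - p ^ (1 + 2)) + gain p 1"
    by (rule s_seq_step_A[OF p2(2) max])
  also have "\<dots> = s_seq (Suc 1) p + (1 - p) ^ 2 * (p ^ 3 * (2 + p) - (1 - p))"
    unfolding x1 gain_def by (simp add: power2_eq_square power3_eq_cube algebra_simps)
  also have "\<dots> > 0" using c p2 q unfolding x1 by (intro add_nonneg_pos mult_pos_pos) auto
  finally show "0 < s p" using convergent_s_seq(2)[OF p2(2) inc, of 1 2] by (simp add: numeral_2_eq_2)
qed

lemma B_forever:
  assumes p: "p \<in> {1/2..<1}" and neg: "\<And>m. B_seq p m \<le> 0"
  shows "\<forall>n\<ge>3. optimal_at p n strategy_B" "convergent (\<lambda>n. s_seq n p)" "B_seq p \<longlonglongrightarrow> s p"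
proof -
  have x: "s_seq (Suc m) p = B_seq p m" for m by (rule s_seq_eq_B_seq[OF p]) (use neg in auto)
  show "\<forall>n\<ge>3. optimal_at p n strategy_B"
  proof (intro allI impI)
    fix n :: nat assume "3 \<le> n"
    then obtain k where k: "n = Suc (Suc k)" "1 \<le> k" by (cases n; cases "n - 1") auto
    show "optimal_at p n strategy_B" unfolding k(1) by (rule optimal_B_of_B_seq[OF p k(2)]) (use neg in auto)
  qed
  have inc: "s_seq (Suc k) p \<le> s_seq (Suc (Suc k)) p" if "1 \<le> k" for k
    unfolding x by (rule B_seq_incr) (use p that neg in auto)
  show "convergent (\<lambda>n. s_seq n p)" by (rule convergent_s_seq(1)[OF _ inc]) (use p in auto)
  have "(\<lambda>n. s_seq n p) \<longlonglongrightarrow> s p" by (rule convergent_s_seq(3)[OF _ inc]) (use p in auto)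
  then show "B_seq p \<longlonglongrightarrow> s p" using LIMSEQ_Suc[of "\<lambda>n. s_seq n p"] by (simp add: x)
qed

text \<open>The first positive value, at \<open>k + 2\<close> coins, is a running maximum because
  all earlier values are nonpositive. It governs the choice one size later, so A starts at
  \<open>k + 3\<close> coins.\<close>

lemma B_then_A:
  assumes p: "p \<in> {544/1000..<1}" and k: "1 \<le> k" and neg: "\<And>m. m \<le> k \<Longrightarrow> B_seq p m \<le> 0"
    and pos: "0 < B_seq p (Suc k)"
  shows "\<forall>n\<ge>3. (n > k + 2 \<longrightarrow> optimal_at p n strategy_A) \<and> (n \<le> k + 2 \<longrightarrow> optimal_at p n strategy_B)"
    "convergent (\<lambda>n. s_seq n p)" "0 < s p" "(\<lambda>n. s_seq n p) \<longlonglongrightarrow> s p"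
    "\<And>m. k < m \<Longrightarrow> s_seq (Suc (Suc m)) p = s_seq (Suc m) p * (1 - p ^ (m + 2)) + gain p m"
    "s_seq (Suc (Suc k)) p = B_seq p (Suc k)"
proof -
  have p2: "p \<in> {1/2..<1}" "p \<in> {0..1}" using p by auto
  have x: "s_seq (Suc m) p = B_seq p m" if "m \<le> Suc k" for m
    by (rule s_seq_eq_B_seq[OF p2(1)]) (use neg that in auto)
  show "s_seq (Suc (Suc k)) p = B_seq p (Suc k)" by (rule x) simp
  have max: "s_seq (Suc m) p \<le> s_seq (Suc (Suc k)) p" if "m \<le> Suc k" for m
    using that neg[of m] pos x[of m] x[of "Suc k"] by (cases "m = Suc k") auto
  have gap: "((1 - p) / p) ^ (Suc k + 2) \<le> 1 - p - s_seq (Suc (Suc k)) p"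
  proof -
    have "Suc k + 2 = k + 3" by simp
    then show ?thesis using switch_dominates[OF p _ pos k] neg[of k] x[of "Suc k"] by (simp only: order_refl)
  qed
  note A = A_regime[OF p2(1) max gap]
  show "s_seq (Suc (Suc m)) p = s_seq (Suc m) p * (1 - p ^ (m + 2)) + gain p m" if "k < m" for m
    by (rule s_seq_step_A[OF p2(2)]) (use A[of m] that in auto)
  have "(n > k + 2 \<longrightarrow> optimal_at p n strategy_A) \<and> (n \<le> k + 2 \<longrightarrow> optimal_at p n strategy_B)" if n: "3 \<le> n" for n
  proof -
    obtain l where l: "n = Suc (Suc l)" "1 \<le> l" using n by (cases n; cases "n - 1") auto
    show ?thesis unfolding l(1)
      using optimal_strategy_A[OF p2(2) l(2)] optimal_B_of_B_seq[OF p2(1) l(2)] A[of l] neg by auto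
  qed
  then show "\<forall>n\<ge>3. (n > k + 2 \<longrightarrow> optimal_at p n strategy_A) \<and> (n \<le> k + 2 \<longrightarrow> optimal_at p n strategy_B)"
    by blast
  have inc: "s_seq (Suc l) p \<le> s_seq (Suc (Suc l)) p" if "Suc k \<le> l" for l
    using A[of "Suc l"] that by auto
  show "convergent (\<lambda>n. s_seq n p)" "(\<lambda>n. s_seq n p) \<longlonglongrightarrow> s p"
    by (rule convergent_s_seq(1,3)[OF p2(2) inc]; assumption)+
  show "0 < s p" using convergent_s_seq(2)[OF p2(2) inc, of "Suc k" "Suc k"] pos x[of "Suc k"] by auto
qed

section \<open>Asymptotics of the switching index\<close>

lemma sum_gain_lower:
  assumes p: "p \<in> {1/2..<1}" and "K \<le> m"
  shows "(\<Sum>i = K..<m. gain p i) = p ^ (K + 2) - p ^ (m + 2) - (1 - p) ^ (K + 2) / p + (1 - p) ^ (m + 2) / p"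
  using assms(2)
proof (induction m rule: dec_induct)
  case (step m)
  have "(1 - p) ^ (m + 2) / p - (1 - p) ^ (Suc m + 2) / p = (1 - p) ^ (m + 2)"
    using p by (simp add: field_simps)
  then show ?case using step by (simp add: gain_def algebra_simps)
qed simp

lemma after_switch_upper:
  assumes p: "p \<in> {1/2..<1}" and b: "B_seq p k \<le> 0" "0 < B_seq p (Suc k)" and "Suc k \<le> m"
  shows "B_seq p m \<le> p ^ (k + 2) - p ^ (m + 2)"
  using assms(4)
proof (induction m rule: dec_induct)
  case base
  show ?case using B_seq_Suc_le_gain[of p k] gain_le[of p k] p b by (simp add: eval_nat_numeral)
next
  case (step m)
  have "0 \<le> B_seq p m * near_all p m"
    using B_seq_pos_after(1)[OF p b step(1)] near_all_nonneg[of p m] p by simp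
  then have "B_seq p (Suc m) \<le> B_seq p m + gain p m" by (simp add: B_seq.simps algebra_simps)
  also have "\<dots> \<le> p ^ (k + 2) - p ^ (m + 3)" using step gain_le[of p m] p by simp
  finally show ?case by (simp add: eval_nat_numeral)
qed

text \<open>After the switch the sequence stays below \<open>p ^ (k + 2)\<close>, so step i loses at
  most \<open>p ^ (k + 2) * weight i\<close> to damping.\<close>

lemma after_switch_lower:
  assumes p: "p \<in> {1/2..5/8}" and b: "B_seq p k \<le> 0" "0 < B_seq p (Suc k)" and "Suc k \<le> m"
  shows "(\<Sum>i = Suc k..<m. gain p i) - p ^ (k + 2) * (\<Sum>i = Suc k..<m. weight i) \<le> B_seq p m"
  using assms(4)
proof (induction m rule: dec_induct)
  case base then show ?case using b by simp
next
  case (step m)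
  have p': "p \<in> {1/2..<1}" using p by auto
  have "B_seq p m \<le> p ^ (k + 2) - p ^ (m + 2)" by (rule after_switch_upper[OF p' b step(1)])
  also have "\<dots> \<le> p ^ (k + 2)" using p by simp
  finally have "B_seq p m * near_all p m \<le> p ^ (k + 2) * weight m"
    using near_all_nonneg[of p m] near_all_le_weight[of p m] p by (intro mult_mono) auto
  then show ?case using step by (simp add: B_seq.simps algebra_simps)
qed

text \<open>The lower bound uses only the positivity of the value at the switch. The two bounds
  therefore differ by about a factor p, one unit of the exponent, which is what the floor in the
  theorem absorbs.\<close>

lemma B_lim_bounds_at_switch:
  assumes p: "p \<in> {1/2..5/8}" and b: "B_seq p k \<le> 0" "0 < B_seq p (Suc k)"
  shows "B_lim p \<le> p ^ (k + 2)"
    "p ^ (k + 2) * (p - ((1 - p) / p) ^ (k + 3) - weight_tail (Suc k)) \<le> B_lim p"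
proof -
  have p': "p \<in> {1/2..<1}" using p by auto
  have "B_seq p m \<le> p ^ (k + 2)" if "Suc k \<le> m" for m
  proof -
    have "0 \<le> p ^ (m + 2)" using p by simp
    then show ?thesis using after_switch_upper[OF p' b that] by linarith
  qed
  then show "B_lim p \<le> p ^ (k + 2)"
    by (intro LIMSEQ_le_const2[OF B_seq_tendsto[OF p]]) blast
  have "p ^ (k + 3) - p ^ (m + 2) - (1 - p) ^ (k + 3) / p - p ^ (k + 2) * weight_tail (Suc k) \<le> B_seq p m"
    if "Suc k \<le> m" for m
  proof -
    have "p ^ (k + 2) * (\<Sum>i = Suc k..<m. weight i) \<le> p ^ (k + 2) * weight_tail (Suc k)"
      using sum_weight_le_tail p by (intro mult_left_mono) auto
    moreover have "0 \<le> (1 - p) ^ (m + 2) / p" using p by simp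
    moreover have "Suc k + 2 = k + 3" by simp
    ultimately show ?thesis using after_switch_lower[OF p b that] sum_gain_lower[OF p' that]
      by (smt (verit))
  qed
  moreover have "(\<lambda>m. p ^ (k + 3) - p ^ (m + 2) - (1 - p) ^ (k + 3) / p - p ^ (k + 2) * weight_tail (Suc k))
      \<longlonglongrightarrow> p ^ (k + 3) - 0 - (1 - p) ^ (k + 3) / p - p ^ (k + 2) * weight_tail (Suc k)"
    using p by (intro tendsto_intros LIMSEQ_ignore_initial_segment LIMSEQ_power_zero) auto
  ultimately have "p ^ (k + 3) - 0 - (1 - p) ^ (k + 3) / p - p ^ (k + 2) * weight_tail (Suc k) \<le> B_lim p"
    by (intro LIMSEQ_le[OF _ B_seq_tendsto[OF p]]) blast+
  also have "p ^ (k + 3) - 0 - (1 - p) ^ (k + 3) / p - p ^ (k + 2) * weight_tail (Suc k) =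
      p ^ (k + 2) * (p - ((1 - p) / p) ^ (k + 3) - weight_tail (Suc k))"
    using p by (simp add: power_divide field_simps eval_nat_numeral)
  finally show "p ^ (k + 2) * (p - ((1 - p) / p) ^ (k + 3) - weight_tail (Suc k)) \<le> B_lim p" .
qed

text \<open>After the switch the two recursions differ only in the damping, so each step adds
  \<open>B_seq p m * (near_all p m - p ^ (m + 2))\<close> to their difference, which is itself
  damped.\<close>

lemma s_minus_B_lim_at_switch:
  assumes p: "p \<in> {544/1000..5/8}" and k: "1 \<le> k" and neg: "\<And>m. m \<le> k \<Longrightarrow> B_seq p m \<le> 0"
    and pos: "0 < B_seq p (Suc k)"
  shows "0 \<le> s p - B_lim p" "s p - B_lim p \<le> p ^ (k + 2) * weight_tail (Suc k)"
proof -
  have p1: "p \<in> {544/1000..<1}" "p \<in> {1/2..<1}" "p \<in> {1/2..5/8}" "p \<in> {0..1}" using p by auto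
  note bA = B_then_A[OF p1(1) k neg pos]
  let ?d = "\<lambda>m. s_seq (Suc m) p - B_seq p m"
  have d: "0 \<le> ?d m \<and> ?d m \<le> p ^ (k + 2) * (\<Sum>i = Suc k..<m. weight i)" if "Suc k \<le> m" for m
    using that
  proof (induction m rule: dec_induct)
    case base then show ?case using bA(6) by simp
  next
    case (step m)
    let ?e = "B_seq p m * (near_all p m - p ^ (m + 2))"
    have e: "?d (Suc m) = ?d m * (1 - p ^ (m + 2)) + ?e"
      using bA(5)[of m] step by (simp add: B_seq.simps algebra_simps)
    have "0 \<le> p ^ (m + 2)" using p by simp
    moreover have "near_all p m \<le> weight m" by (rule near_all_le_weight) (use p in auto)
    moreover have "0 \<le> near_all p m - p ^ (m + 2)" using p by (simp add: near_all_def)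
    ultimately have n: "0 \<le> near_all p m - p ^ (m + 2)" "near_all p m - p ^ (m + 2) \<le> weight m"
      by linarith+
    have bm: "0 < B_seq p m" using B_seq_pos_after(1)[OF p1(2) neg pos step(1)] by simp
    have "B_seq p m \<le> p ^ (k + 2) - p ^ (m + 2)" by (rule after_switch_upper[OF p1(2) neg pos step(1)]) simp
    also have "\<dots> \<le> p ^ (k + 2)" using p by simp
    finally have "?e \<le> p ^ (k + 2) * weight m" using n bm by (intro mult_mono) auto
    moreover have "0 \<le> ?e" using n bm by (intro mult_nonneg_nonneg) auto
    moreover have "0 \<le> ?d m * (1 - p ^ (m + 2))"
      using step p1 by (intro mult_nonneg_nonneg) (auto intro: power_le_one simp del: power_Suc)
    moreover have "?d m * (1 - p ^ (m + 2)) \<le> ?d m"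
      using step p1 by (intro mult_left_le) (auto simp del: power_Suc)
    moreover have "(\<Sum>i = Suc k..<Suc m. weight i) = (\<Sum>i = Suc k..<m. weight i) + weight m"
      using step by simp
    ultimately show ?case unfolding e using step by (simp add: distrib_left)
  qed
  have lim: "?d \<longlonglongrightarrow> s p - B_lim p"
    by (intro tendsto_intros B_seq_tendsto LIMSEQ_Suc[OF bA(4)] p1)
  show "0 \<le> s p - B_lim p" by (rule LIMSEQ_le_const[OF lim]) (use d in blast)
  have "p ^ (k + 2) * (\<Sum>i = Suc k..<m. weight i) \<le> p ^ (k + 2) * weight_tail (Suc k)" for m
    using sum_weight_le_tail p by (intro mult_left_mono) auto
  then show "s p - B_lim p \<le> p ^ (k + 2) * weight_tail (Suc k)"
    by (intro LIMSEQ_le_const2[OF lim] exI[of _ "Suc k"]) (meson d order_trans)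
qed

text \<open>The factor multiplying \<open>p ^ (switch p + 1)\<close> in the lower bound of
  \<open>B_lim_bounds_at_switch\<close>.\<close>

definition margin :: "real \<Rightarrow> real" where
  "margin p = p - ((1 - p) / p) ^ (switch p + 2) - weight_tail (switch p)"

definition log_ratio :: "real \<Rightarrow> real \<Rightarrow> real \<Rightarrow> real" where
  "log_ratio p0 D p = (ln (p - p0) + ln D) / ln p0"

text \<open>
  The term \<open>\<epsilon>(p)\<close>: the smallest shift moving \<open>log_ratio\<close> into \<open>[N, N + 1)\<close>; since that interval is open on
  the right, a positive amount tending to 0 is subtracted when shifting down.
\<close>

definition correction :: "real \<Rightarrow> real \<Rightarrow> real \<Rightarrow> real" where
  "correction p0 D p = (let N = real (switch p + 1) in
     if log_ratio p0 D p < N then N - log_ratio p0 D p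
     else if log_ratio p0 D p < N + 1 then 0
     else N + 1 - log_ratio p0 D p - min 1 (p - p0))"

text \<open>When the ratio is shifted down, the cap 1 keeps the result at least N, and
  \<open>p0 < p\<close> keeps it below \<open>N + 1\<close>.\<close>

lemma floor_correction:
  assumes "p0 < p"
  shows "\<lfloor>log_ratio p0 D p + correction p0 D p\<rfloor> = int (switch p + 1)"
  unfolding floor_eq_iff using assms by (auto simp: correction_def Let_def min_def)

lemma B_lim_zero_exists:
  obtains p0 where "54950217776417 / 10 ^ 14 \<le> p0" "p0 \<le> 54950217776423 / 10 ^ 14" "B_lim p0 = 0"
proof -
  let ?a = "54950217776417 / 10 ^ 14 :: real" and ?c = "54950217776423 / 10 ^ 14 :: real"
  have "B_lim ?a \<le> 0"
    by (rule LIMSEQ_le_const2[OF B_seq_tendsto]) (use B_seq_neg_below in auto)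
  moreover have "0 < B_lim ?c" by (rule B_lim_pos[OF _ B_seq_pos_above]) simp
  moreover have "continuous_on {?a..?c} B_lim"
    by (intro continuous_at_imp_continuous_on ballI DERIV_isCont[OF B_lim_differentiable(1)]) auto
  ultimately show ?thesis using that IVT'[of B_lim ?a 0 ?c] by (auto simp: less_imp_le)
qed

section \<open>Behaviour at and to the right of the zero p0\<close>

context
  fixes p0 :: real
  assumes p0: "p0 \<in> {549/1000..55/100}" and zero: "B_lim p0 = 0"
begin

lemma B_seq_p0_nonpos: "B_seq p0 k \<le> 0"
  using B_lim_pos[of p0 k] zero p0 by force

text \<open>A zero at k would persist, as the sequence increases and stays nonpositive. Two
  consecutive gains would then vanish, which forces \<open>p0 = 1 - p0\<close>.\<close>

lemma B_seq_p0_neg: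
  assumes "1 \<le> k" shows "B_seq p0 k < 0"
proof (rule ccontr)
  assume "\<not> ?thesis"
  then have k: "B_seq p0 k = 0" using B_seq_p0_nonpos[of k] by simp
  have up: "B_seq p0 m \<le> B_seq p0 (Suc m)" if "1 \<le> m" for m
    by (rule B_seq_incr) (use p0 that B_seq_p0_nonpos in auto)
  have k1: "B_seq p0 (Suc k) = 0" using up[OF assms] k B_seq_p0_nonpos[of "Suc k"] by simp
  have k2: "B_seq p0 (Suc (Suc k)) = 0" using up[of "Suc k"] k1 B_seq_p0_nonpos[of "Suc (Suc k)"] by simp
  have "gain p0 k = 0" "gain p0 (Suc k) = 0" using k k1 k2 by (simp_all add: B_seq.simps(2))
  then have "p0 ^ (k + 2) * (1 - p0) = (1 - p0) ^ (k + 2)"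
    "p0 * (p0 ^ (k + 2) * (1 - p0)) = (1 - p0) * (1 - p0) ^ (k + 2)"
    by (simp_all add: gain_def mult_ac)
  then have "(p0 - (1 - p0)) * (1 - p0) ^ (k + 2) = 0" by (simp add: left_diff_distrib del: power_Suc)
  then show False using p0 by simp
qed

lemma below:
  assumes "1/2 \<le> p" "p \<le> p0" shows "B_seq p k \<le> 0" "s p = B_lim p"
proof -
  show n: "B_seq p k \<le> 0" for k
    using B_seq_strict_mono_in_p[of p p0 k] B_seq_p0_nonpos assms p0
    by (cases "p = p0") (auto intro: order_trans)
  have "B_seq p \<longlonglongrightarrow> s p" by (rule B_forever) (use n assms p0 in auto)
  moreover have "B_seq p \<longlonglongrightarrow> B_lim p" by (rule B_seq_tendsto) (use assms p0 in auto)
  ultimately show "s p = B_lim p" by (rule LIMSEQ_unique)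
qed

lemma s_neg_below: "1/2 \<le> p \<Longrightarrow> p < p0 \<Longrightarrow> s p < 0"
  using B_lim_strict_mono[of p p0] below[of p] B_seq_p0_nonpos p0 zero by simp

lemma s_p0: "s p0 = 0" using below(2)[of p0] zero p0 by simp

text \<open>Without a positive value, \<open>B_lim_strict_mono\<close> would make
  \<open>B_lim p\<close> positive although it is a limit of nonpositive terms. The switch comes
  after index 1 because \<open>B_seq p 1\<close> is negative below \<phi>.\<close>

lemma switch_between:
  assumes p: "p0 < p" "p < \<phi>"
  obtains k where "switch p = Suc k" "1 \<le> k" "\<And>m. m \<le> k \<Longrightarrow> B_seq p m \<le> 0" "0 < B_seq p (Suc k)"
proof -
  have p': "p \<in> {1/2..5/8}" using p p0 phi_bounds by auto
  have "\<exists>n. 0 < B_seq p n"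
  proof (rule ccontr)
    assume "\<not> ?thesis"
    then have n: "\<And>n. B_seq p n \<le> 0" by (simp add: not_less)
    then have "B_lim p0 < B_lim p" using B_lim_strict_mono[of p0 p] p p0 p' by auto
    moreover have "B_lim p \<le> 0" by (rule LIMSEQ_le_const2[OF B_seq_tendsto[OF p']]) (use n in auto)
    ultimately show False using zero by simp
  qed
  then obtain n where "0 < B_seq p n" by blast
  then obtain k where k: "switch p = Suc k" and neg: "\<And>m. m \<le> k \<Longrightarrow> B_seq p m \<le> 0"
    and pos: "0 < B_seq p (Suc k)"
    using switch_cases by metis
  have "B_seq p 1 < 0"
    unfolding One_nat_def B_seq_1 using quadratic_sign(1)[of p] p p' by (intro mult_pos_neg) auto
  then have "1 \<le> k" using pos by (cases k) auto
  then show thesis using that k neg pos by auto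
qed

lemma eventually_between: "eventually (\<lambda>p. p0 < p \<and> p < \<phi>) (at_right p0)"
proof -
  have "p0 < \<phi>" using p0 phi_bounds by simp
  then show ?thesis unfolding eventually_at_right[OF \<open>p0 < \<phi>\<close>] by blast
qed

text \<open>Finitely many terms, all strictly negative at p0, stay negative nearby by
  continuity.\<close>

lemma switch_at_top: "filterlim switch at_top (at_right p0)"
  unfolding filterlim_at_top_ge[where c = 1]
proof (intro allI impI)
  fix K :: nat assume "1 \<le> K"
  have "eventually (\<lambda>p. \<forall>m\<in>{1..K}. B_seq p m < 0) (at_right p0)"
  proof (intro eventually_ball_finite ballI)
    fix m assume "m \<in> {1..K}"
    then have "B_seq p0 m < 0" by (intro B_seq_p0_neg) auto
    moreover have "((\<lambda>p. B_seq p m) \<longlongrightarrow> B_seq p0 m) (at_right p0)"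
      using isCont_B_seq[where k = m and p = p0] unfolding isCont_def by (rule filterlim_mono) (auto simp: at_le)
    ultimately show "eventually (\<lambda>p. B_seq p m < 0) (at_right p0)" by (intro order_tendstoD(2))
  qed simp
  then show "eventually (\<lambda>p. K \<le> switch p) (at_right p0)"
    using eventually_between
  proof eventually_elim
    case (elim p)
    then obtain k where k: "switch p = Suc k" "0 < B_seq p (Suc k)" by (metis switch_between)
    show ?case
    proof (rule ccontr)
      assume "\<not> K \<le> switch p"
      then have "Suc k \<in> {1..K}" using k by simp
      then show False using elim(1) k(2) by fastforce
    qed
  qed
qed

lemma tail_switch: "((\<lambda>p. weight_tail (switch p)) \<longlongrightarrow> 0) (at_right p0)"
  by (rule filterlim_compose[OF weight_tail_tendsto_0 switch_at_top])

lemma margin_tendsto: "(margin \<longlongrightarrow> p0) (at_right p0)"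
proof -
  have "((\<lambda>n. (5/6::real) ^ (n + 2)) \<longlongrightarrow> 0) at_top"
    by (rule LIMSEQ_ignore_initial_segment) (rule LIMSEQ_power_zero, simp)
  then have g: "((\<lambda>p. (5/6::real) ^ (switch p + 2)) \<longlongrightarrow> 0) (at_right p0)"
    by (rule filterlim_compose[OF _ switch_at_top])
  have r: "((\<lambda>p. ((1 - p) / p) ^ (switch p + 2)) \<longlongrightarrow> 0) (at_right p0)"
  proof (rule Lim_null_comparison[OF _ g])
    show "eventually (\<lambda>p. norm (((1 - p) / p) ^ (switch p + 2)) \<le> (5/6) ^ (switch p + 2)) (at_right p0)"
      using eventually_between
    proof eventually_elim
      case (elim p)
      \<comment> \<open>The bound 5/6 holds as soon as \<open>p \<ge> 6/11\<close>, which is below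
        549/1000.\<close>
      then have "0 \<le> (1 - p) / p" "(1 - p) / p \<le> 5/6" using p0 phi_bounds by (auto simp: field_simps)
      then show ?case by (simp add: power_mono del: power_Suc)
    qed
  qed
  have "(margin \<longlongrightarrow> p0 - 0 - 0) (at_right p0)"
    unfolding margin_def[abs_def] by (intro tendsto_intros r tail_switch)
  then show ?thesis by simp
qed

lemma between_bounds:
  assumes p: "p0 < p" "p < \<phi>"
  shows "B_lim p \<le> p ^ (switch p + 1)" "p ^ (switch p + 1) * margin p \<le> B_lim p" "0 < B_lim p"
    "0 \<le> s p - B_lim p" "s p - B_lim p \<le> p ^ (switch p + 1) * weight_tail (switch p)"
proof -
  obtain k where k: "switch p = Suc k" "1 \<le> k" "\<And>m. m \<le> k \<Longrightarrow> B_seq p m \<le> 0" "0 < B_seq p (Suc k)"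
    using switch_between[OF p] by metis
  have p': "p \<in> {1/2..5/8}" "p \<in> {544/1000..5/8}" using p p0 phi_bounds by auto
  have e: "switch p + 1 = k + 2" "switch p + 2 = k + 3" using k by auto
  show "B_lim p \<le> p ^ (switch p + 1)" "p ^ (switch p + 1) * margin p \<le> B_lim p"
    unfolding margin_def e unfolding k(1)
    using B_lim_bounds_at_switch[OF p'(1) k(3) k(4)] by auto
  show "0 < B_lim p" by (rule B_lim_pos[OF p'(1) k(4)])
  show "0 \<le> s p - B_lim p" "s p - B_lim p \<le> p ^ (switch p + 1) * weight_tail (switch p)"
    unfolding e unfolding k(1) using s_minus_B_lim_at_switch[OF p'(2) k(2-4)] by auto
qed

context
  fixes D :: real
  assumes D: "(B_lim has_real_derivative D) (at p0)" "0 < D"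
begin

lemma B_lim_quotient: "((\<lambda>p. B_lim p / (p - p0)) \<longlongrightarrow> D) (at p0)"
  using D(1) unfolding has_field_derivative_iff by (simp add: zero)

lemma B_lim_quotient_right: "((\<lambda>p. B_lim p / (p - p0)) \<longlongrightarrow> D) (at_right p0)"
  using B_lim_quotient by (simp add: filterlim_at_split)

text \<open>On the left \<open>s\<close> and \<open>B_lim\<close> coincide. On the right their
  difference is at most \<open>B_lim p * weight_tail (switch p) / margin p\<close>; divided by
  \<open>p - p0\<close>, this tends to \<open>D * 0 / p0\<close>.\<close>

lemma s_has_derivative: "(s has_real_derivative D) (at p0)"
  unfolding has_field_derivative_iff s_p0 filterlim_at_split diff_0_right
proof
  have "eventually (\<lambda>p. B_lim p / (p - p0) = s p / (p - p0)) (at_left p0)"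
    using eventually_at_left[of "1/2" p0] p0 below(2) by (auto intro!: exI[of _ "1/2"])
  moreover have "((\<lambda>p. B_lim p / (p - p0)) \<longlongrightarrow> D) (at_left p0)"
    using B_lim_quotient by (simp add: filterlim_at_split)
  ultimately show "((\<lambda>p. s p / (p - p0)) \<longlongrightarrow> D) (at_left p0)"
    by (rule Lim_transform_eventually[rotated])
  have "((\<lambda>p. (B_lim p / (p - p0)) * (weight_tail (switch p) / margin p)) \<longlongrightarrow> D * (0 / p0)) (at_right p0)"
    by (intro tendsto_intros B_lim_quotient_right tail_switch margin_tendsto) (use p0 in auto)
  then have small: "((\<lambda>p. (B_lim p / (p - p0)) * (weight_tail (switch p) / margin p)) \<longlongrightarrow> 0) (at_right p0)"
    by simp
  have "eventually (\<lambda>p. 0 < margin p) (at_right p0)"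
    by (rule order_tendstoD(1)[OF margin_tendsto]) (use p0 in auto)
  then have "eventually (\<lambda>p. norm ((s p - B_lim p) / (p - p0)) \<le>
      (B_lim p / (p - p0)) * (weight_tail (switch p) / margin p)) (at_right p0)"
    using eventually_between
  proof eventually_elim
    case (elim p)
    note b = between_bounds[of p]
    have "p ^ (switch p + 1) \<le> B_lim p / margin p" using b(2) elim by (simp add: pos_le_divide_eq)
    then have "p ^ (switch p + 1) * weight_tail (switch p) \<le> B_lim p / margin p * weight_tail (switch p)"
      by (intro mult_right_mono weight_tail_nonneg)
    then have "s p - B_lim p \<le> B_lim p / margin p * weight_tail (switch p)" using b(5) elim by linarith
    then have "(s p - B_lim p) / (p - p0) \<le> B_lim p / margin p * weight_tail (switch p) / (p - p0)"
      using elim by (intro divide_right_mono) auto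
    moreover have "0 \<le> (s p - B_lim p) / (p - p0)" using b(4) elim by simp
    ultimately show ?case unfolding real_norm_def by (subst abs_of_nonneg) (simp_all add: mult_ac)
  qed
  then have "((\<lambda>p. (s p - B_lim p) / (p - p0)) \<longlongrightarrow> 0) (at_right p0)"
    using small by (rule Lim_null_comparison)
  from tendsto_add[OF B_lim_quotient_right this]
  show "((\<lambda>p. s p / (p - p0)) \<longlongrightarrow> D) (at_right p0)"
    by (simp add: add_divide_distrib[symmetric])
qed

lemma log_B_lim_asymp: "((\<lambda>p. ln (B_lim p) / ln p - log_ratio p0 D p) \<longlongrightarrow> 0) (at_right p0)"
proof -
  have ln0: "ln p0 < 0" using p0 by simp
  have "((\<lambda>p. ln (B_lim p / (p - p0)) - ln D) \<longlongrightarrow> ln D - ln D) (at_right p0)"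
    by (rule tendsto_diff[OF tendsto_ln[OF B_lim_quotient_right] tendsto_const]) (use D in simp)
  moreover have lnp: "((\<lambda>p. ln p) \<longlongrightarrow> ln p0) (at_right p0)"
    by (intro tendsto_intros) (use p0 in auto)
  ultimately have 1: "((\<lambda>p. (ln (B_lim p / (p - p0)) - ln D) / ln p) \<longlongrightarrow> (ln D - ln D) / ln p0) (at_right p0)"
    using ln0 by (intro tendsto_divide) auto
  \<comment> \<open>Changing the base of the logarithm from p to p0 costs
    \<open>(ln (p - p0) + ln D) * (1 / ln p - 1 / ln p0)\<close>. This is split into a factor that
    tends to 0 and a convergent difference quotient.\<close>
  have "((\<lambda>x. x * (ln x + ln D)) \<longlongrightarrow> 0) (at_right 0)" by real_asymp
  then have 2: "((\<lambda>p. (p - p0) * (ln (p - p0) + ln D)) \<longlongrightarrow> 0) (at_right p0)"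
    by (subst filterlim_at_right_to_0) simp
  have "((\<lambda>p. 1 / ln p) has_real_derivative - (1 / p0) / (ln p0)^2) (at p0)"
    using p0 ln0 by (auto intro!: derivative_eq_intros simp: power2_eq_square)
  then have 3: "((\<lambda>p. (1 / ln p - 1 / ln p0) / (p - p0)) \<longlongrightarrow> - (1 / p0) / (ln p0)^2) (at_right p0)"
    by (simp add: has_field_derivative_iff filterlim_at_split)
  have "((\<lambda>p. (ln (B_lim p / (p - p0)) - ln D) / ln p + (p - p0) * (ln (p - p0) + ln D) *
       ((1 / ln p - 1 / ln p0) / (p - p0))) \<longlongrightarrow> (ln D - ln D) / ln p0 + 0 * (- (1 / p0) / (ln p0)^2)) (at_right p0)"
    by (intro tendsto_add tendsto_mult 1 2 3)
  then have "((\<lambda>p. (ln (B_lim p / (p - p0)) - ln D) / ln p + (p - p0) * (ln (p - p0) + ln D) *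
       ((1 / ln p - 1 / ln p0) / (p - p0))) \<longlongrightarrow> 0) (at_right p0)" by simp
  moreover have "eventually (\<lambda>p. (ln (B_lim p / (p - p0)) - ln D) / ln p + (p - p0) * (ln (p - p0) + ln D) *
       ((1 / ln p - 1 / ln p0) / (p - p0)) = ln (B_lim p) / ln p - log_ratio p0 D p) (at_right p0)"
    using eventually_between
  proof eventually_elim
    case (elim p)
    have "ln (B_lim p / (p - p0)) = ln (B_lim p) - ln (p - p0)"
      using between_bounds(3)[of p] elim by (simp add: ln_div)
    moreover have "(p - p0) * (ln (p - p0) + ln D) * ((1 / ln p - 1 / ln p0) / (p - p0)) =
        (ln (p - p0) + ln D) * (1 / ln p - 1 / ln p0)" using elim by simp
    ultimately show ?case by (simp add: log_ratio_def diff_divide_distrib right_diff_distrib add_divide_distrib)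
  qed
  ultimately show ?thesis by (rule Lim_transform_eventually)
qed

text \<open>The bounds on \<open>B_lim p\<close> place its logarithm to base p between N and
  \<open>N + ln (margin p) / ln p\<close>, and the last quotient tends to 1. By
  \<open>log_B_lim_asymp\<close>, \<open>log_ratio\<close> is within o(1) of the interval from N to
  \<open>N + 1\<close>.\<close>

lemma correction_tendsto: "(correction p0 D \<longlongrightarrow> 0) (at_right p0)"
proof (rule Lim_null_comparison)
  let ?e = "\<lambda>p. \<bar>ln (B_lim p) / ln p - log_ratio p0 D p\<bar> + \<bar>ln (margin p) / ln p - 1\<bar> + \<bar>p - p0\<bar>"
  have ln0: "ln p0 < 0" using p0 by simp
  have "(?e \<longlongrightarrow> \<bar>0\<bar> + \<bar>ln p0 / ln p0 - 1\<bar> + \<bar>p0 - p0\<bar>) (at_right p0)"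
    by (intro tendsto_intros log_B_lim_asymp margin_tendsto) (use p0 ln0 in auto)
  then show "(?e \<longlongrightarrow> 0) (at_right p0)" using ln0 by simp
  have "eventually (\<lambda>p. 0 < margin p) (at_right p0)"
    by (rule order_tendstoD(1)[OF margin_tendsto]) (use p0 in auto)
  then show "eventually (\<lambda>p. norm (correction p0 D p) \<le> ?e p) (at_right p0)"
    using eventually_between
  proof eventually_elim
    case (elim p)
    define N where "N = real (switch p + 1)"
    define w where "w = ln (B_lim p) / ln p"
    note b = between_bounds[of p]
    have p: "0 < p" "p < 1" using elim p0 phi_bounds by auto
    then have lnp: "ln p < 0" by simp
    have "ln (B_lim p) \<le> ln (p ^ (switch p + 1))" using b(1,3) elim p by (subst ln_le_cancel_iff) auto
    also have "\<dots> = N * ln p" unfolding N_def by (rule ln_realpow)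
    finally have 1: "N \<le> w" using lnp by (simp add: w_def neg_le_divide_eq)
    have "N * ln p + ln (margin p) = ln (p ^ (switch p + 1) * margin p)"
      using p elim ln_realpow[of p "switch p + 1"] by (subst ln_mult) (auto simp: N_def simp del: power_Suc)
    also have "\<dots> \<le> ln (B_lim p)" using b(2,3) elim p by (subst ln_le_cancel_iff) auto
    finally have "w * ln p \<ge> (N + ln (margin p) / ln p) * ln p" using lnp by (simp add: w_def distrib_right)
    then have 2: "w \<le> N + ln (margin p) / ln p" using lnp by simp
    show ?case using 1 2 elim unfolding correction_def Let_def N_def[symmetric] w_def[symmetric]
      by (auto simp: abs_if min_def)
  qed
qed

end

end

section \<open>Assembly of the three regimes\<close>

theorem theorem1:
  shows "(\<forall>p\<in>{1/2..<1}. \<forall>n\<ge>3. optimal_at p n strategy_A \<or> optimal_at p n strategy_B) \<and>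
    (\<forall>p\<in>{1/2..<1}. convergent (\<lambda>n. s_seq n p)) \<and>
    (\<exists>p\<^sub>0 s'.
       p\<^sub>0 \<in> {1/2..<1} \<and> s p\<^sub>0 = 0 \<and> (\<forall>q\<in>{1/2..<1}. s q = 0 \<longrightarrow> q = p\<^sub>0) \<and>
       \<bar>p\<^sub>0 - 0.5495021777642\<bar> < 5 / 10 ^ 14 \<and>
       (s has_real_derivative s') (at p\<^sub>0) \<and> 0 < s' \<and>
       (\<exists>(N :: real \<Rightarrow> nat) (\<epsilon> :: real \<Rightarrow> real).
          (\<epsilon> \<longlongrightarrow> 0) (at_right p\<^sub>0) \<and>
          (\<forall>p\<in>{p\<^sub>0<..<\<phi>}. 0 < N p \<and>
             int (N p) = \<lfloor>(ln (p - p\<^sub>0) + ln s') / ln p\<^sub>0 + \<epsilon> p\<rfloor>) \<and>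
          (\<forall>p\<in>{1/2..<1}. \<exists>!k::nat.
             k = 1 \<and> \<phi> \<le> p \<and> p < 1 \<and> (\<forall>n\<ge>3. optimal_at p n strategy_A) \<or>
             k = 2 \<and> p\<^sub>0 < p \<and> p < \<phi> \<and>
               (\<forall>n\<ge>3. (n > N p \<longrightarrow> optimal_at p n strategy_A) \<and>
                      (n \<le> N p \<longrightarrow> optimal_at p n strategy_B)) \<or>
             k = 3 \<and> 1/2 \<le> p \<and> p \<le> p\<^sub>0 \<and> (\<forall>n\<ge>3. optimal_at p n strategy_B))))"
proof -
  obtain p0 where p0_bounds: "54950217776417 / 10 ^ 14 \<le> p0" "p0 \<le> 54950217776423 / 10 ^ 14"
    and zero: "B_lim p0 = 0"
    by (rule B_lim_zero_exists)
  have p0: "p0 \<in> {549/1000..55/100}" using p0_bounds by simp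
  have p0_phi: "p0 < \<phi>" "\<phi> < 1" using p0 phi_bounds by auto
  obtain D where D: "(B_lim has_real_derivative D) (at p0)" "0 < D"
    using B_lim_deriv_pos[of p0] B_seq_p0_nonpos[OF p0 zero] p0 by auto
  \<comment> \<open>The shift by 1 converts the index of \<open>B_seq\<close> into a number of
    coins.\<close>
  let ?N = "\<lambda>p. switch p + 1" and ?\<epsilon> = "correction p0 D"
  have low: "(\<forall>n\<ge>3. optimal_at p n strategy_B) \<and> convergent (\<lambda>n. s_seq n p)"
    if "1/2 \<le> p" "p \<le> p0" for p
    using B_forever[of p] below(1)[OF p0 zero that] that p0 by auto
  have mid: "(\<forall>n\<ge>3. (n > ?N p \<longrightarrow> optimal_at p n strategy_A) \<and> (n \<le> ?N p \<longrightarrow> optimal_at p n strategy_B)) \<and>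
      convergent (\<lambda>n. s_seq n p) \<and> 0 < s p" if between: "p0 < p" "p < \<phi>" for p
  proof -
    obtain k where k: "switch p = Suc k" "1 \<le> k" "\<And>m. m \<le> k \<Longrightarrow> B_seq p m \<le> 0" "0 < B_seq p (Suc k)"
      using switch_between[OF p0 zero between] by metis
    have "p \<in> {544/1000..<1}" using between p0 p0_phi by auto
    from B_then_A(1-3)[OF this k(2-4)] show ?thesis by (simp add: k(1))
  qed
  have high: "(\<forall>n\<ge>3. optimal_at p n strategy_A) \<and> convergent (\<lambda>n. s_seq n p) \<and> 0 < s p"
    if "\<phi> \<le> p" "p < 1" for p
    using large_p[of p] that by auto
  show ?thesis
  proof (rule conjI[OF _ conjI[OF _ exI[of _ p0, OF exI[of _ D]]]];
      intro conjI ballI exI[of _ ?N] exI[of _ ?\<epsilon>])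
    fix p :: real assume p: "p \<in> {1/2..<1}"
    then consider "p \<le> p0" "1/2 \<le> p" | "p0 < p" "p < \<phi>" | "\<phi> \<le> p" "p < 1" by fastforce
    note cases = this
    show "\<forall>n\<ge>3. optimal_at p n strategy_A \<or> optimal_at p n strategy_B"
    proof (cases rule: cases)
      case 1 then show ?thesis using low[of p] by blast
    next
      case 2 then show ?thesis using mid[of p] by (meson not_less)
    next
      case 3 then show ?thesis using high[of p] by blast
    qed
    show "convergent (\<lambda>n. s_seq n p)"
      using low[of p] mid[of p] high[of p] by (cases rule: cases) simp_all
    show "s p = 0 \<longrightarrow> p = p0"
      using s_neg_below[OF p0 zero, of p] mid[of p] high[of p] by (cases rule: cases) force+
    show "\<exists>!k::nat.
             k = 1 \<and> \<phi> \<le> p \<and> p < 1 \<and> (\<forall>n\<ge>3. optimal_at p n strategy_A) \<or>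
             k = 2 \<and> p0 < p \<and> p < \<phi> \<and>
               (\<forall>n\<ge>3. (n > ?N p \<longrightarrow> optimal_at p n strategy_A) \<and>
                      (n \<le> ?N p \<longrightarrow> optimal_at p n strategy_B)) \<or>
             k = 3 \<and> 1/2 \<le> p \<and> p \<le> p0 \<and> (\<forall>n\<ge>3. optimal_at p n strategy_B)"
    proof (cases rule: cases)
      case 1 show ?thesis by (rule ex1I[of _ 3]) (use 1 low[of p] p0_phi in auto)
    next
      case 2 show ?thesis by (rule ex1I[of _ 2]) (use 2 mid[of p] in auto)
    next
      case 3 show ?thesis by (rule ex1I[of _ 1]) (use 3 high[of p] p0_phi in auto)
    qed
  next
    fix p assume "p \<in> {p0<..<\<phi>}"
    then show "int (?N p) = \<lfloor>(ln (p - p0) + ln D) / ln p0 + ?\<epsilon> p\<rfloor>"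
      using floor_correction[of p0 p D] by (simp add: log_ratio_def)
  next
    show "\<bar>p0 - 0.5495021777642\<bar> < 5 / 10 ^ 14" using p0_bounds unfolding abs_less_iff by simp
    show "s p0 = 0" by (rule s_p0[OF p0 zero])
    show "(s has_real_derivative D) (at p0)" by (rule s_has_derivative[OF p0 zero D])
    show "(?\<epsilon> \<longlongrightarrow> 0) (at_right p0)" by (rule correction_tendsto[OF p0 zero D])
  qed (use p0 D in auto)
qed

end
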